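(* Assume $LM=\Omega(d)$ and $d\ge 8$. If an optimization algorithm $\mathcal A$ queries at most $K$ points and guarantees that $\min_{k\le K}|f(x^{(k)})-f(x^* )|<1$ with constant probability for every $L$-smooth function $f:\mathbb R^d\to\mathbb R$ such that the distribution $\mu$ with density $\propto e^{-f}$ has second moment $\Theta(M)$, then $K\ge (\alpha\cdot LM)^{d/2}$ for some universal constant $\alpha>0$.
   Context: $x^*$ is the minimizer of $f$ and $x^{(k)}$ is the point queried by the algorithm at step $k$; the algorithm accesses $f$ only through queries of its value and gradient at chosen points. $f$ is $L$-smooth if $\nabla f$ is $L$-Lipschitz. The second moment of $\mu$ is $\mathbb E_{X\sim\mu}\|X\|^2$. *)

theory Defs
  imports "HOL-Probability.Probability"
begin

text \<open>
  The dimension is quantified inside the statement, after the universal constant, so it cannot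
  be a type. Points of the Euclidean space of dimension \<open>d\<close> are extensional functions on \<open>{..<d}\<close>;
  they form the underlying space of the product of \<open>d\<close> copies of \<^const>\<open>lborel\<close>.
\<close>

type_synonym point = "nat \<Rightarrow> real"

definition Rd :: "nat \<Rightarrow> point set" where
  "Rd d = {..<d} \<rightarrow>\<^sub>E UNIV"

definition Rd_lborel :: "nat \<Rightarrow> point measure" where
  "Rd_lborel d = Pi\<^sub>M {..<d} (\<lambda>_. lborel)"

definition Rd_norm :: "nat \<Rightarrow> point \<Rightarrow> real" where
  "Rd_norm d x = L2_set x {..<d}"

definition Rd_dist :: "nat \<Rightarrow> point \<Rightarrow> point \<Rightarrow> real" where
  "Rd_dist d x y = Rd_norm d (\<lambda>i. x i - y i)"

text \<open>Frechet differentiability of \<open>f\<close> at \<open>x\<close>, with the derivative represented by the vector \<open>g\<close>.\<close>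

definition has_gradient :: "nat \<Rightarrow> (point \<Rightarrow> real) \<Rightarrow> point \<Rightarrow> point \<Rightarrow> bool" where
  "has_gradient d f g x \<longleftrightarrow> g \<in> Rd d \<and>
     (\<forall>e>0. \<exists>\<delta>>0. \<forall>y\<in>Rd d. Rd_dist d y x < \<delta> \<longrightarrow>
        \<bar>f y - f x - (\<Sum>i<d. g i * (y i - x i))\<bar> \<le> e * Rd_dist d y x)"

definition gradient :: "nat \<Rightarrow> (point \<Rightarrow> real) \<Rightarrow> point \<Rightarrow> point" where
  "gradient d f x = (THE g. has_gradient d f g x)"

definition smooth :: "nat \<Rightarrow> real \<Rightarrow> (point \<Rightarrow> real) \<Rightarrow> bool" where
  "smooth d L f \<longleftrightarrow>
     (\<forall>x\<in>Rd d. \<exists>g. has_gradient d f g x) \<and>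
     (\<forall>x\<in>Rd d. \<forall>y\<in>Rd d. Rd_dist d (gradient d f x) (gradient d f y) \<le> L * Rd_dist d x y)"

definition minimizer :: "nat \<Rightarrow> (point \<Rightarrow> real) \<Rightarrow> point \<Rightarrow> bool" where
  "minimizer d f z \<longleftrightarrow> z \<in> Rd d \<and> (\<forall>x\<in>Rd d. f z \<le> f x)"

text \<open>
  The distribution with density proportional to \<open>exp (- f)\<close>. It is a probability measure when
  \<open>exp (- f)\<close> is integrable, which is required separately wherever it is used.
\<close>

definition gibbs :: "nat \<Rightarrow> (point \<Rightarrow> real) \<Rightarrow> point measure" where
  "gibbs d f = density (Rd_lborel d)
     (\<lambda>x. ennreal (exp (- f x) / (\<integral>y. exp (- f y) \<partial>Rd_lborel d)))"

definition second_moment :: "nat \<Rightarrow> point measure \<Rightarrow> ennreal" where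
  "second_moment d \<mu> = (\<integral>\<^sup>+ x. ennreal ((Rd_norm d x)\<^sup>2) \<partial>\<mu>)"

text \<open>
  Integration by parts gives \<open>d \<le> L * E|X|^2\<close> for every \<open>L\<close>-smooth \<open>f\<close>. So the constants in
  \<open>L * M \<ge> c * d\<close> and \<open>a * M \<le> E|X|^2 \<le> b * M\<close> are compatible for all admissible
  \<open>L\<close> and \<open>M\<close> only if \<open>b * c \<ge> 1\<close>; for \<open>b * c = 1\<close> and \<open>L * M = c * d\<close> only a Gaussian
  remains.
\<close>

text \<open>
  For a fixed random seed, an algorithm maps the history of queried points together with the
  returned values and gradients to the next point to query. It sees \<open>f\<close> in no other way.
  An algorithm that stops early is represented by one that repeats a query.
\<close>

type_synonym history = "(point \<times> real \<times> point) list"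

primrec transcript :: "nat \<Rightarrow> (point \<Rightarrow> real) \<Rightarrow> (history \<Rightarrow> point) \<Rightarrow> nat \<Rightarrow> history" where
  "transcript d f A 0 = []"
| "transcript d f A (Suc k) =
     (let h = transcript d f A k; x = A h in h @ [(x, f x, gradient d f x)])"

definition query :: "nat \<Rightarrow> (point \<Rightarrow> real) \<Rightarrow> (history \<Rightarrow> point) \<Rightarrow> nat \<Rightarrow> point" where
  "query d f A k = A (transcript d f A k)"

text \<open>
  A randomized algorithm draws its seed (possibly a whole sequence of reals) from an arbitrary
  probability space \<open>P\<close> and then proceeds deterministically. No measurability of \<open>A\<close> in the seed
  is required: a non-measurable event has \<^const>\<open>measure\<close> zero, so a positive success probability
  as in \<open>guarantees\<close> already forces the success event to be measurable. The steps
  are numbered \<open>0, ..., K - 1\<close>, and the minimum over them is less than 1 iff some step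
  is within 1 (never, if \<open>K = 0\<close>).
\<close>

definition randomized_algorithm ::
    "nat \<Rightarrow> (nat \<Rightarrow> real) measure \<Rightarrow> ((nat \<Rightarrow> real) \<Rightarrow> history \<Rightarrow> point) \<Rightarrow> bool" where
  "randomized_algorithm d P A \<longleftrightarrow> prob_space P \<and> (\<forall>\<omega>\<in>space P. \<forall>h. A \<omega> h \<in> Rd d)"

definition guarantees ::
    "nat \<Rightarrow> (nat \<Rightarrow> real) measure \<Rightarrow> ((nat \<Rightarrow> real) \<Rightarrow> history \<Rightarrow> point) \<Rightarrow> nat \<Rightarrow> real \<Rightarrow>
     (point \<Rightarrow> real) \<Rightarrow> bool" where
  "guarantees d P A K p f \<longleftrightarrow>
     (\<forall>z. minimizer d f z \<longrightarrow>
        p \<le> measure P {\<omega> \<in> space P. \<exists>k<K. \<bar>f (query d f (A \<omega>) k) - f z\<bar> < 1})"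

end

(*
  The hard functions are a basin, flat on a cube and quadratic outside, minus a bump of depth 1 and
  radius r ~ 1 / sqrt L centred at a point of the cube. Off the bump such a function agrees with the
  basin and exceeds its minimum by at least 1, so an algorithm succeeds only by querying inside the
  bump, and up to that moment it runs as on the basin. Of N disjoint bumps, K queries can therefore
  find each with probability p only if p * N <= K. The cube has side ~ sqrt (M / d), and a ball of
  radius r has volume at most (C * r / sqrt d) ^ d, so greedy packing gives N >= (c' * L * M) ^ (d / 2).

  The basin is a sum of one-dimensional profiles with curvature kappa / (M / d), where
  1 / b < kappa < min (1 / a) c. The strict inequalities leave room for the flat part and the bump:
  curvature (1 - kappa / c) * L remains for the bump, and a narrow flat part moves the second moment
  only slightly away from that of the Gaussian, M / kappa.
*)
theory Submission
  imports Defs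
begin

section \<open>Gradients\<close>

text \<open>The constant \<open>\<alpha>\<close> is fixed before the dimension, so no estimate may
  degrade with \<open>d\<close>. This is why the basin has product form: with scale
  \<open>sqrt (M / d)\<close> in each coordinate, its second moment is \<open>M\<close> times a
  one-dimensional ratio, and a single flat width \<open>\<epsilon>\<close> serves every dimension.
  The flat part gives every pit the same bottom value -1, wherever its centre lies in the cube; on a
  Gaussian the height of the basin at the centre would spoil the unit gap.

  A pit must not push the second moment out of its window either. The cube is \<open>q ^ d\<close>
  times as large as the volume bound for a ball of doubled radius, where \<open>q^2\<close> is
  proportional to \<open>L * M\<close>. Hence the volume of a pit is at most
  \<open>1 / q ^ d\<close> of the integral of the basin density, and for \<open>d \<ge> 2\<close>
  this is at most \<open>1 / q^2\<close>, small for large \<open>L * M\<close> whatever the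
  dimension. For small \<open>L * M\<close> the claimed bound is at most 1, and it remains to see
  that some query is made.

  Averaging over the seed yields \<open>p * q ^ d \<le> K\<close>; the factor \<open>p\<close> moves
  into \<open>\<alpha>\<close> because \<open>sqrt p ^ d \<le> p\<close> for
  \<open>d \<ge> 2\<close>.\<close>

lemma Rd_dist_nonneg [simp]: "0 \<le> Rd_dist d x y"
  by (simp add: Rd_dist_def Rd_norm_def L2_set_nonneg)

lemma Rd_norm_sq: "(Rd_norm d x)\<^sup>2 = (\<Sum>i<d. (x i)\<^sup>2)"
  by (simp add: Rd_norm_def L2_set_def sum_nonneg)

lemma Rd_dist_self [simp]: "Rd_dist d x x = 0"
  by (simp add: Rd_dist_def Rd_norm_def L2_set_def)

lemma Rd_dist_sq: "(Rd_dist d x y)\<^sup>2 = (\<Sum>i<d. (x i - y i)\<^sup>2)"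
  by (simp add: Rd_dist_def Rd_norm_sq)

lemma Rd_dist_commute: "Rd_dist d x y = Rd_dist d y x"
  by (simp add: Rd_dist_def Rd_norm_def L2_set_def power2_commute)

lemma Rd_dist_triangle: "Rd_dist d x z \<le> Rd_dist d x y + Rd_dist d y z"
  using L2_set_triangle_ineq[of "\<lambda>i. x i - y i" "\<lambda>i. y i - z i" "{..<d}"]
  by (simp add: Rd_dist_def Rd_norm_def)

lemma Rd_norm_scale: "Rd_norm d (\<lambda>i. c * x i) = \<bar>c\<bar> * Rd_norm d x"
  by (simp add: Rd_norm_def L2_set_def power_mult_distrib sum_distrib_left[symmetric] real_sqrt_mult)

lemma Rd_norm_cong: "(\<And>i. i < d \<Longrightarrow> x i = y i) \<Longrightarrow> Rd_norm d x = Rd_norm d y"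
  by (simp add: Rd_norm_def L2_set_def)

text \<open>Makes the description in \<open>gradient\<close> meaningful. Moving one coordinate of
  \<open>x\<close> isolates the corresponding entry of the gradient.\<close>

lemma has_gradient_unique:
  assumes "has_gradient d f g x" "has_gradient d f h x" "x \<in> Rd d"
  shows "g = h"
proof (rule PiE_ext[where k = "{..<d}" and s = "\<lambda>_. UNIV"])
  show "g \<in> {..<d} \<rightarrow>\<^sub>E UNIV" "h \<in> {..<d} \<rightarrow>\<^sub>E UNIV"
    using assms by (auto simp: has_gradient_def Rd_def)
  fix i assume i: "i \<in> {..<d}"
  have "\<bar>g i - h i\<bar> \<le> 2 * e" if e: "e > 0" for e
  proof -
    obtain \<delta> where \<delta>: "\<delta> > 0" "\<And>y. y \<in> Rd d \<Longrightarrow> Rd_dist d y x < \<delta> \<Longrightarrow>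
        \<bar>f y - f x - (\<Sum>i<d. g i * (y i - x i))\<bar> \<le> e * Rd_dist d y x"
      using assms(1) e unfolding has_gradient_def by meson
    obtain \<delta>' where \<delta>': "\<delta>' > 0" "\<And>y. y \<in> Rd d \<Longrightarrow> Rd_dist d y x < \<delta>' \<Longrightarrow>
        \<bar>f y - f x - (\<Sum>i<d. h i * (y i - x i))\<bar> \<le> e * Rd_dist d y x"
      using assms(2) e unfolding has_gradient_def by meson
    define t where "t = min \<delta> \<delta>' / 2"
    have t: "0 < t" "t < \<delta>" "t < \<delta>'" using \<delta> \<delta>' by (auto simp: t_def)
    define y where "y = x(i := x i + t)"
    have y: "y \<in> Rd d" using assms(3) i by (auto simp: Rd_def y_def PiE_def extensional_def)
    have yx: "y j - x j = (if j = i then t else 0)" for j by (simp add: y_def)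
    have "(Rd_dist d y x)\<^sup>2 = t\<^sup>2"
      unfolding Rd_dist_sq yx using i by (simp add: if_distrib[where f = "\<lambda>u. u\<^sup>2"] cong: if_cong)
    hence dist: "Rd_dist d y x = t" using t by simp
    have sum: "(\<Sum>j<d. k j * (y j - x j)) = k i * t" for k :: point
      unfolding yx using i by (simp add: if_distrib[where f = "\<lambda>u. _ * u"] cong: if_cong)
    have "\<bar>f y - f x - g i * t\<bar> \<le> e * t" "\<bar>f y - f x - h i * t\<bar> \<le> e * t"
      using \<delta>(2)[OF y] \<delta>'(2)[OF y] t by (simp_all add: dist sum)
    hence "\<bar>g i * t - h i * t\<bar> \<le> (2 * e) * t" by linarith
    hence "\<bar>g i - h i\<bar> * t \<le> (2 * e) * t"
      using t by (metis abs_mult abs_of_pos left_diff_distrib)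
    thus ?thesis using t by simp
  qed
  \<comment> \<open>A nonzero difference would be at most half of itself.\<close>
  from this[of "\<bar>g i - h i\<bar> / 4"] show "g i = h i" by fastforce
qed

lemma gradient_eq: "has_gradient d f g x \<Longrightarrow> x \<in> Rd d \<Longrightarrow> gradient d f x = g"
  unfolding gradient_def by (rule the_equality) (auto intro: has_gradient_unique)

lemma smoothI:
  assumes "\<And>x. x \<in> Rd d \<Longrightarrow> has_gradient d f (G x) x"
    and "\<And>x y. x \<in> Rd d \<Longrightarrow> y \<in> Rd d \<Longrightarrow> Rd_dist d (G x) (G y) \<le> L * Rd_dist d x y"
  shows "smooth d L f"
  unfolding smooth_def using assms gradient_eq by metis

lemma has_gradient_quadratic:
  assumes "g \<in> Rd d" "\<delta> > 0" "C \<ge> 0"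
    and "\<And>y. y \<in> Rd d \<Longrightarrow> Rd_dist d y x < \<delta> \<Longrightarrow>
      \<bar>f y - f x - (\<Sum>i<d. g i * (y i - x i))\<bar> \<le> C * (Rd_dist d y x)\<^sup>2"
  shows "has_gradient d f g x"
  unfolding has_gradient_def
proof (intro conjI allI impI)
  fix e :: real assume e: "e > 0"
  \<comment> \<open>\<open>C + 1\<close> instead of \<open>C\<close>, since \<open>C\<close> may be
    0.\<close>
  define \<delta>' where "\<delta>' = min \<delta> (e / (C + 1))"
  have "\<delta>' > 0" using assms e by (simp add: \<delta>'_def)
  moreover have "\<bar>f y - f x - (\<Sum>i<d. g i * (y i - x i))\<bar> \<le> e * Rd_dist d y x"
    if y: "y \<in> Rd d" "Rd_dist d y x < \<delta>'" for y
  proof -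
    have "C * Rd_dist d y x \<le> (C + 1) * (e / (C + 1))"
      using y assms(3) e by (intro mult_mono) (auto simp: \<delta>'_def)
    also have "\<dots> = e" using assms(3) by (simp add: field_simps)
    finally have "C * Rd_dist d y x * Rd_dist d y x \<le> e * Rd_dist d y x"
      by (intro mult_right_mono) auto
    thus ?thesis using assms(4)[OF y(1)] y(2) by (simp add: \<delta>'_def power2_eq_square)
  qed
  ultimately show "\<exists>\<delta>>0. \<forall>y\<in>Rd d. Rd_dist d y x < \<delta> \<longrightarrow>
      \<bar>f y - f x - (\<Sum>i<d. g i * (y i - x i))\<bar> \<le> e * Rd_dist d y x" by blast
qed (use assms in auto)

lemma has_gradient_diff:
  assumes "has_gradient d f g x" "has_gradient d h k x"
  shows "has_gradient d (\<lambda>y. f y - h y) (\<lambda>i\<in>{..<d}. g i - k i) x"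
  unfolding has_gradient_def
proof (intro conjI allI impI)
  show "(\<lambda>i\<in>{..<d}. g i - k i) \<in> Rd d" by (simp add: Rd_def)
  fix e :: real assume "e > 0"
  hence e: "e / 2 > 0" by simp
  obtain \<delta> where \<delta>: "\<delta> > 0" "\<And>y. y \<in> Rd d \<Longrightarrow> Rd_dist d y x < \<delta> \<Longrightarrow>
      \<bar>f y - f x - (\<Sum>i<d. g i * (y i - x i))\<bar> \<le> e / 2 * Rd_dist d y x"
    using assms(1) e unfolding has_gradient_def by meson
  obtain \<delta>' where \<delta>': "\<delta>' > 0" "\<And>y. y \<in> Rd d \<Longrightarrow> Rd_dist d y x < \<delta>' \<Longrightarrow>
      \<bar>h y - h x - (\<Sum>i<d. k i * (y i - x i))\<bar> \<le> e / 2 * Rd_dist d y x"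
    using assms(2) e unfolding has_gradient_def by meson
  have "\<bar>(f y - h y) - (f x - h x) - (\<Sum>i<d. (\<lambda>i\<in>{..<d}. g i - k i) i * (y i - x i))\<bar>
      \<le> e * Rd_dist d y x" if y: "y \<in> Rd d" "Rd_dist d y x < min \<delta> \<delta>'" for y
  proof -
    have "(\<Sum>i<d. (\<lambda>i\<in>{..<d}. g i - k i) i * (y i - x i))
        = (\<Sum>i<d. g i * (y i - x i)) - (\<Sum>i<d. k i * (y i - x i))"
      by (simp add: sum_subtractf[symmetric] left_diff_distrib)
    thus ?thesis using \<delta>(2)[OF y(1)] \<delta>'(2)[OF y(1)] y(2) by (simp add: abs_if split: if_splits)
  qed
  thus "\<exists>\<delta>>0. \<forall>y\<in>Rd d. Rd_dist d y x < \<delta> \<longrightarrow>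
     \<bar>(f y - h y) - (f x - h x) - (\<Sum>i<d. (\<lambda>i\<in>{..<d}. g i - k i) i * (y i - x i))\<bar>
      \<le> e * Rd_dist d y x"
    using \<delta>(1) \<delta>'(1) by (intro exI[of _ "min \<delta> \<delta>'"]) auto
qed

lemma Rd_dist_diff_le:
  "Rd_dist d (\<lambda>i\<in>{..<d}. g i - k i) (\<lambda>i\<in>{..<d}. g' i - k' i) \<le> Rd_dist d g g' + Rd_dist d k k'"
proof -
  have "Rd_dist d (\<lambda>i\<in>{..<d}. g i - k i) (\<lambda>i\<in>{..<d}. g' i - k' i)
      = L2_set (\<lambda>i. (g i - g' i) + (k' i - k i)) {..<d}"
    unfolding Rd_dist_def Rd_norm_def by (intro L2_set_cong) auto
  also have "\<dots> \<le> Rd_dist d g g' + Rd_dist d k' k"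
    unfolding Rd_dist_def Rd_norm_def by (rule L2_set_triangle_ineq)
  finally show ?thesis by (simp add: Rd_dist_commute[of d k'])
qed

text \<open>The Taylor remainders of the coordinates add up to \<open>C\<close> times the squared
  distance, so the constant does not grow with \<open>d\<close>.\<close>

lemma has_gradient_separable:
  assumes C: "\<And>s t. \<bar>g s - g t - g' t * (s - t)\<bar> \<le> C * (s - t)\<^sup>2" "C \<ge> 0"
  shows "has_gradient d (\<lambda>x. \<Sum>i<d. g (x i)) (\<lambda>i\<in>{..<d}. g' (x i)) x"
proof (rule has_gradient_quadratic[of _ _ 1 C])
  fix y
  have "\<bar>(\<Sum>i<d. g (y i)) - (\<Sum>i<d. g (x i)) - (\<Sum>i<d. (\<lambda>i\<in>{..<d}. g' (x i)) i * (y i - x i))\<bar>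
     = \<bar>\<Sum>i<d. g (y i) - g (x i) - g' (x i) * (y i - x i)\<bar>"
    by (simp add: sum_subtractf)
  also have "\<dots> \<le> (\<Sum>i<d. C * (y i - x i)\<^sup>2)"
    by (rule order_trans[OF sum_abs]) (intro sum_mono C)
  finally show "\<bar>(\<Sum>i<d. g (y i)) - (\<Sum>i<d. g (x i))
      - (\<Sum>i<d. (\<lambda>i\<in>{..<d}. g' (x i)) i * (y i - x i))\<bar> \<le> C * (Rd_dist d y x)\<^sup>2"
    by (simp add: Rd_dist_sq sum_distrib_left)
qed (use C in \<open>auto simp: Rd_def\<close>)

lemma Rd_dist_separable_le:
  assumes "\<And>s t. \<bar>g' s - g' t\<bar> \<le> L * \<bar>s - t\<bar>" "L \<ge> 0"
  shows "Rd_dist d (\<lambda>i\<in>{..<d}. g' (x i)) (\<lambda>i\<in>{..<d}. g' (y i)) \<le> L * Rd_dist d x y"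
proof -
  have "(Rd_dist d (\<lambda>i\<in>{..<d}. g' (x i)) (\<lambda>i\<in>{..<d}. g' (y i)))\<^sup>2 = (\<Sum>i<d. (g' (x i) - g' (y i))\<^sup>2)"
    by (simp add: Rd_dist_sq)
  also have "\<dots> \<le> (\<Sum>i<d. L\<^sup>2 * (x i - y i)\<^sup>2)"
  proof (rule sum_mono)
    fix i
    show "(g' (x i) - g' (y i))\<^sup>2 \<le> L\<^sup>2 * (x i - y i)\<^sup>2"
      using power_mono[OF assms(1)[of "x i" "y i"], of 2] by (simp add: power_mult_distrib)
  qed
  also have "\<dots> = (L * Rd_dist d x y)\<^sup>2"
    by (simp add: power_mult_distrib Rd_dist_sq sum_distrib_left)
  finally show ?thesis by (rule power2_le_imp_le) (use assms(2) in simp)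
qed

section \<open>Basins and bumps\<close>

text \<open>For \<open>\<epsilon> \<ge> 0\<close> this is \<open>t\<close> minus its projection onto
  \<open>[-\<epsilon>, \<epsilon>]\<close> (soft thresholding). Its square is the squared distance
  to that interval: flat on it, and with Lipschitz derivative.\<close>

definition deadzone :: "real \<Rightarrow> real \<Rightarrow> real" where
  "deadzone \<epsilon> t = t - max (- \<epsilon>) (min \<epsilon> t)"

lemma deadzone_lipschitz: "\<bar>deadzone \<epsilon> s - deadzone \<epsilon> t\<bar> \<le> \<bar>s - t\<bar>" if "\<epsilon> \<ge> 0"
  using that unfolding deadzone_def by (auto simp: max_def min_def abs_if)

lemma deadzone_eq_0_iff: "\<epsilon> \<ge> 0 \<Longrightarrow> deadzone \<epsilon> t = 0 \<longleftrightarrow> \<bar>t\<bar> \<le> \<epsilon>"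
  unfolding deadzone_def by (auto simp: max_def min_def abs_if)

text \<open>Serves differentiability only. The Lipschitz constant of the gradient comes from
  \<open>deadzone_lipschitz\<close>, so the 3 never enters the comparison with
  \<open>L\<close>.\<close>

lemma deadzone_taylor:
  assumes "\<epsilon> \<ge> 0"
  shows "\<bar>(deadzone \<epsilon> s)\<^sup>2 - (deadzone \<epsilon> t)\<^sup>2 - 2 * deadzone \<epsilon> t * (s - t)\<bar> \<le> 3 * (s - t)\<^sup>2"
proof -
  define D where "D = deadzone \<epsilon>"
  have 1: "(D s - D t)\<^sup>2 \<le> (s - t)\<^sup>2"
    using deadzone_lipschitz[OF assms] unfolding D_def abs_le_square_iff by blast
  \<comment> \<open>If the increments of \<open>D\<close> and of its argument differ while
    \<open>D t\<close> is nonzero, then \<open>s\<close> has left the linear branch through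
    \<open>t\<close>, and the step from \<open>t\<close> to \<open>s\<close> covers at least the
    distance \<open>|D t|\<close> to the kink.\<close>
  have 2: "\<bar>D t * ((D s - D t) - (s - t))\<bar> \<le> \<bar>s - t\<bar> * \<bar>s - t\<bar>"
  proof (cases "(D s - D t) - (s - t) = 0")
    case False
    hence "\<bar>D t\<bar> \<le> \<bar>s - t\<bar>" "\<bar>(D s - D t) - (s - t)\<bar> \<le> \<bar>s - t\<bar>"
      using assms unfolding D_def deadzone_def by (auto simp: max_def min_def abs_if split: if_splits)
    thus ?thesis unfolding abs_mult by (intro mult_mono) auto
  qed auto
  have "(D s)\<^sup>2 - (D t)\<^sup>2 - 2 * D t * (s - t) = (D s - D t)\<^sup>2 + 2 * (D t * ((D s - D t) - (s - t)))"
    by (simp add: algebra_simps power2_eq_square)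
  moreover have "\<bar>s - t\<bar> * \<bar>s - t\<bar> = (s - t)\<^sup>2" by (simp add: power2_eq_square abs_mult[symmetric])
  moreover have "(D s - D t)\<^sup>2 \<ge> 0" by simp
  ultimately show ?thesis unfolding D_def[symmetric] using 1 2 by linarith
qed

section \<open>Separable basins\<close>

definition profile :: "real \<Rightarrow> real \<Rightarrow> real \<Rightarrow> real" where
  "profile \<kappa> \<epsilon> t = \<kappa> / 2 * (deadzone \<epsilon> t)\<^sup>2"

definition basin :: "nat \<Rightarrow> real \<Rightarrow> real \<Rightarrow> real \<Rightarrow> point \<Rightarrow> real" where
  "basin d \<kappa> \<epsilon> \<sigma> x = (\<Sum>i<d. profile \<kappa> \<epsilon> (x i / \<sigma>))"

definition basin_grad :: "nat \<Rightarrow> real \<Rightarrow> real \<Rightarrow> real \<Rightarrow> point \<Rightarrow> point" where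
  "basin_grad d \<kappa> \<epsilon> \<sigma> x = (\<lambda>i\<in>{..<d}. \<kappa> / \<sigma> * deadzone \<epsilon> (x i / \<sigma>))"

lemma has_gradient_basin:
  assumes "\<kappa> \<ge> 0" "\<epsilon> \<ge> 0" "\<sigma> > 0"
  shows "has_gradient d (basin d \<kappa> \<epsilon> \<sigma>) (basin_grad d \<kappa> \<epsilon> \<sigma> x) x"
  unfolding basin_grad_def basin_def[abs_def]
proof (rule has_gradient_separable[where g = "\<lambda>t. profile \<kappa> \<epsilon> (t / \<sigma>)"
      and g' = "\<lambda>t. \<kappa> / \<sigma> * deadzone \<epsilon> (t / \<sigma>)" and C = "\<kappa> / 2 * (3 / \<sigma>\<^sup>2)"])
  fix s t
  have "profile \<kappa> \<epsilon> (s / \<sigma>) - profile \<kappa> \<epsilon> (t / \<sigma>) - \<kappa> / \<sigma> * deadzone \<epsilon> (t / \<sigma>) * (s - t)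
    = \<kappa> / 2 * ((deadzone \<epsilon> (s / \<sigma>))\<^sup>2 - (deadzone \<epsilon> (t / \<sigma>))\<^sup>2
        - 2 * deadzone \<epsilon> (t / \<sigma>) * (s / \<sigma> - t / \<sigma>))"
    unfolding profile_def by (simp add: algebra_simps diff_divide_distrib)
  also have "\<bar>\<dots>\<bar> \<le> \<kappa> / 2 * (3 * (s / \<sigma> - t / \<sigma>)\<^sup>2)"
    unfolding abs_mult using deadzone_taylor[OF assms(2), of "s / \<sigma>" "t / \<sigma>"] assms(1)
    by (simp add: mult_left_mono)
  also have "\<dots> = \<kappa> / 2 * (3 / \<sigma>\<^sup>2) * (s - t)\<^sup>2"
    by (simp add: diff_divide_distrib[symmetric] power_divide)
  finally show "\<bar>profile \<kappa> \<epsilon> (s / \<sigma>) - profile \<kappa> \<epsilon> (t / \<sigma>)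
      - \<kappa> / \<sigma> * deadzone \<epsilon> (t / \<sigma>) * (s - t)\<bar> \<le> \<kappa> / 2 * (3 / \<sigma>\<^sup>2) * (s - t)\<^sup>2" .
qed (use assms in auto)

lemma basin_grad_lipschitz:
  assumes "\<kappa> \<ge> 0" "\<epsilon> \<ge> 0" "\<sigma> > 0"
  shows "Rd_dist d (basin_grad d \<kappa> \<epsilon> \<sigma> x) (basin_grad d \<kappa> \<epsilon> \<sigma> y) \<le> \<kappa> / \<sigma>\<^sup>2 * Rd_dist d x y"
  unfolding basin_grad_def
proof (rule Rd_dist_separable_le[where g' = "\<lambda>t. \<kappa> / \<sigma> * deadzone \<epsilon> (t / \<sigma>)"])
  fix s t
  have "\<bar>\<kappa> / \<sigma> * deadzone \<epsilon> (s / \<sigma>) - \<kappa> / \<sigma> * deadzone \<epsilon> (t / \<sigma>)\<bar>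
      = \<kappa> / \<sigma> * \<bar>deadzone \<epsilon> (s / \<sigma>) - deadzone \<epsilon> (t / \<sigma>)\<bar>"
    using assms unfolding right_diff_distrib[symmetric] abs_mult by simp
  also have "\<dots> \<le> \<kappa> / \<sigma> * \<bar>s / \<sigma> - t / \<sigma>\<bar>"
    using assms by (intro mult_left_mono deadzone_lipschitz) auto
  also have "\<dots> = \<kappa> / \<sigma>\<^sup>2 * \<bar>s - t\<bar>"
    using assms(3) by (simp add: diff_divide_distrib[symmetric] power2_eq_square)
  finally show "\<bar>\<kappa> / \<sigma> * deadzone \<epsilon> (s / \<sigma>) - \<kappa> / \<sigma> * deadzone \<epsilon> (t / \<sigma>)\<bar> \<le> \<kappa> / \<sigma>\<^sup>2 * \<bar>s - t\<bar>" .
qed (use assms in auto)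

lemma basin_nonneg: "\<kappa> \<ge> 0 \<Longrightarrow> 0 \<le> basin d \<kappa> \<epsilon> \<sigma> x"
  unfolding basin_def profile_def by (intro sum_nonneg) auto

lemma basin_eq_0:
  assumes "\<epsilon> \<ge> 0" "\<sigma> > 0" "\<And>i. i < d \<Longrightarrow> \<bar>x i\<bar> \<le> \<epsilon> * \<sigma>"
  shows "basin d \<kappa> \<epsilon> \<sigma> x = 0"
proof -
  have "deadzone \<epsilon> (x i / \<sigma>) = 0" if "i < d" for i
    using assms(1,2) assms(3)[OF that] by (simp add: deadzone_eq_0_iff field_simps)
  thus ?thesis by (simp add: basin_def profile_def)
qed

text \<open>Squaring the positive part lets the gradient fade to 0 continuously at the sphere, and
  the squared distance avoids a kink at the centre.\<close>

definition bump :: "nat \<Rightarrow> real \<Rightarrow> point \<Rightarrow> point \<Rightarrow> real" where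
  "bump d r v x = (max 0 (1 - (Rd_dist d x v / r)\<^sup>2))\<^sup>2"

definition bump_grad :: "nat \<Rightarrow> real \<Rightarrow> point \<Rightarrow> point \<Rightarrow> point" where
  "bump_grad d r v x = (\<lambda>i\<in>{..<d}. - 4 / r\<^sup>2 * max 0 (1 - (Rd_dist d x v / r)\<^sup>2) * (x i - v i))"

lemma bump_bounds: "0 \<le> bump d r v x" "bump d r v x \<le> 1"
  unfolding bump_def by (auto intro!: power_le_one)

lemma bump_outside:
  assumes "r > 0" "r \<le> Rd_dist d x v"
  shows "bump d r v x = 0" "bump_grad d r v x = (\<lambda>i\<in>{..<d}. 0)"
proof -
  have "1 \<le> Rd_dist d x v / r" using assms by simp
  hence "1 \<le> (Rd_dist d x v / r)\<^sup>2" by (rule one_le_power)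
  hence "max 0 (1 - (Rd_dist d x v / r)\<^sup>2) = 0" by simp
  thus "bump d r v x = 0" "bump_grad d r v x = (\<lambda>i\<in>{..<d}. 0)"
    by (simp_all add: bump_def bump_grad_def)
qed

lemma bump_centre: "bump d r v v = 1"
  by (simp add: bump_def)

text \<open>The derivative of \<open>(max 0 (1 - t))^2\<close> is
  \<open>- 2 * max 0 (1 - t)\<close>, which is 2-Lipschitz. The bump is this function of a scaled
  squared distance.\<close>

lemma square_plus_taylor:
  "\<bar>(max 0 (1 - s))\<^sup>2 - (max 0 (1 - t))\<^sup>2 + 2 * max 0 (1 - t) * (s - t)\<bar> \<le> (s - t)\<^sup>2" for s t :: real
proof -
  consider "s \<le> 1" "t \<le> 1" | "s > 1" "t \<le> 1" | "s \<le> 1" "t > 1" | "s > 1" "t > 1" by linarith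
  thus ?thesis
  proof cases
    case 1
    have "(1 - s)\<^sup>2 - (1 - t)\<^sup>2 + 2 * (1 - t) * (s - t) = (s - t)\<^sup>2"
      by (simp add: algebra_simps power2_eq_square)
    thus ?thesis using 1 by simp
  next
    case 2
    \<comment> \<open>The remainder is rewritten twice: this form bounds it from above, the one
      further down shows that it is nonnegative.\<close>
    have "- (1 - t)\<^sup>2 + 2 * (1 - t) * (s - t) = (s - t)\<^sup>2 - (s - 1)\<^sup>2"
      by (simp add: algebra_simps power2_eq_square)
    moreover have "0 \<le> (1 - t) * (s - 1)" "(1 - t)\<^sup>2 \<ge> 0" using 2 by auto
    moreover have "- (1 - t)\<^sup>2 + 2 * (1 - t) * (s - t) = (1 - t)\<^sup>2 + 2 * ((1 - t) * (s - 1))"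
      by (simp add: algebra_simps power2_eq_square)
    ultimately have "0 \<le> - (1 - t)\<^sup>2 + 2 * (1 - t) * (s - t)"
      "- (1 - t)\<^sup>2 + 2 * (1 - t) * (s - t) \<le> (s - t)\<^sup>2"
      using zero_le_power2[of "s - 1"] by linarith+
    thus ?thesis using 2 by (simp add: max_def)
  next
    case 3
    have "(1 - s)\<^sup>2 \<le> (t - s)\<^sup>2" using 3 by (intro power_mono) auto
    thus ?thesis using 3 by (simp add: max_def power2_commute)
  next
    case 4
    thus ?thesis by (simp add: max_def)
  qed
qed

lemma has_gradient_bump:
  assumes "r > 0"
  shows "has_gradient d (bump d r v) (bump_grad d r v x) x"
\<comment> \<open>The radius 1 gives \<open>Y + X \<le> 2 * X + 1\<close>. In the constant, the
  first term stems from the quadratic part of the change of the squared distance, the second from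
  the remainder of the outer function. It may depend on \<open>x\<close>, because differentiability
  is claimed one point at a time.\<close>
proof (rule has_gradient_quadratic[of _ _ 1 "2 / r\<^sup>2 + (2 * Rd_dist d x v + 1)\<^sup>2 / (r\<^sup>2)\<^sup>2"])
  fix y assume y: "Rd_dist d y x < 1"
  define X Y D where "X = Rd_dist d x v" and "Y = Rd_dist d y v" and "D = Rd_dist d y x"
  define I where "I = (\<Sum>i<d. (x i - v i) * (y i - x i))"
  define w where "w = max 0 (1 - (X / r)\<^sup>2)"
  have nn: "0 \<le> X" "0 \<le> Y" "0 \<le> D" by (simp_all add: X_def Y_def D_def)
  have w: "0 \<le> w" "w \<le> 1" by (auto simp: w_def)
  have I: "Y\<^sup>2 - X\<^sup>2 = 2 * I + D\<^sup>2"
    unfolding X_def Y_def D_def I_def Rd_dist_sq sum_subtractf[symmetric] sum_distrib_left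
      sum.distrib[symmetric]
    by (intro sum.cong refl) (simp add: algebra_simps power2_eq_square)
  have "\<bar>Y - X\<bar> \<le> D"
    using Rd_dist_triangle[of d y v x] Rd_dist_triangle[of d x v y]
    by (simp add: X_def Y_def D_def Rd_dist_commute[of d x y] abs_le_iff)
  moreover have "Y + X \<le> 2 * X + 1" using calculation y by (simp add: D_def)
  ultimately have "\<bar>Y - X\<bar> * (Y + X) \<le> D * (2 * X + 1)"
    using nn by (intro mult_mono) auto
  moreover have "\<bar>Y\<^sup>2 - X\<^sup>2\<bar> = \<bar>Y - X\<bar> * (Y + X)"
    using nn by (simp add: power2_eq_square square_diff_square_factored abs_mult)
  ultimately have "\<bar>Y\<^sup>2 - X\<^sup>2\<bar> \<le> D * (2 * X + 1)" by simp
  hence sq: "(Y\<^sup>2 - X\<^sup>2)\<^sup>2 \<le> (D * (2 * X + 1))\<^sup>2"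
    by (metis abs_ge_zero power2_abs power_mono)
  have lin: "(\<Sum>i<d. bump_grad d r v x i * (y i - x i)) = - (4 / r\<^sup>2 * w * I)"
    by (simp add: bump_grad_def I_def w_def X_def sum_distrib_left mult.assoc sum_negf)
  have "\<bar>(max 0 (1 - (Y / r)\<^sup>2))\<^sup>2 - w\<^sup>2 + 2 * w * ((Y / r)\<^sup>2 - (X / r)\<^sup>2)\<bar> \<le> ((Y / r)\<^sup>2 - (X / r)\<^sup>2)\<^sup>2"
    unfolding w_def by (rule square_plus_taylor)
  moreover have "(Y / r)\<^sup>2 - (X / r)\<^sup>2 = (Y\<^sup>2 - X\<^sup>2) / r\<^sup>2"
    by (simp add: power_divide diff_divide_distrib)
  ultimately have T: "\<bar>bump d r v y - bump d r v x + 2 * w * ((Y\<^sup>2 - X\<^sup>2) / r\<^sup>2)\<bar> \<le> ((Y\<^sup>2 - X\<^sup>2) / r\<^sup>2)\<^sup>2"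
    unfolding bump_def X_def[symmetric] Y_def[symmetric] w_def[symmetric] by simp
  have "2 * w * ((Y\<^sup>2 - X\<^sup>2) / r\<^sup>2) = 4 / r\<^sup>2 * w * I + 2 / r\<^sup>2 * w * D\<^sup>2"
    unfolding I by (simp add: add_divide_distrib algebra_simps)
  moreover have "\<bar>u - - p\<bar> \<le> \<bar>q\<bar> + e" if "\<bar>u + (p + q)\<bar> \<le> e" for u p q e :: real
    using that by linarith
  ultimately have "\<bar>bump d r v y - bump d r v x - (\<Sum>i<d. bump_grad d r v x i * (y i - x i))\<bar>
      \<le> \<bar>2 / r\<^sup>2 * w * D\<^sup>2\<bar> + ((Y\<^sup>2 - X\<^sup>2) / r\<^sup>2)\<^sup>2"
    using T unfolding lin by presburger
  also have "\<bar>2 / r\<^sup>2 * w * D\<^sup>2\<bar> \<le> 2 / r\<^sup>2 * 1 * D\<^sup>2"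
    using w by (simp add: abs_mult mult_mono divide_right_mono mult_right_mono)
  also have "((Y\<^sup>2 - X\<^sup>2) / r\<^sup>2)\<^sup>2 \<le> (D * (2 * X + 1))\<^sup>2 / (r\<^sup>2)\<^sup>2"
    unfolding power_divide using sq by (intro divide_right_mono) auto
  finally show "\<bar>bump d r v y - bump d r v x - (\<Sum>i<d. bump_grad d r v x i * (y i - x i))\<bar>
      \<le> (2 / r\<^sup>2 + (2 * Rd_dist d x v + 1)\<^sup>2 / (r\<^sup>2)\<^sup>2) * (Rd_dist d y x)\<^sup>2"
    unfolding X_def[symmetric] D_def[symmetric] distrib_right power_mult_distrib
    by (simp add: mult.commute)
qed (auto simp: bump_grad_def Rd_def)

text \<open>The gradient is \<open>- 4 / r^2\<close> times a weight times the displacement from the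
  centre. The weight is at most 1, and inside the ball it changes at rate at most
  \<open>2 / r\<close>, which multiplies a vector shorter than \<open>r\<close>: hence
  \<open>4 * (1 + 2)\<close>.\<close>

lemma bump_grad_lipschitz:
  assumes "r > 0"
  shows "Rd_dist d (bump_grad d r v x) (bump_grad d r v y) \<le> 12 / r\<^sup>2 * Rd_dist d x y"
proof -
  \<comment> \<open>By symmetry \<open>y\<close> is the point nearer to the centre. The difference
    of the weights then multiplies \<open>y - v\<close>, which is shorter than \<open>r\<close> even
    when \<open>x\<close> lies far outside the ball.\<close>
  have main: "Rd_dist d (bump_grad d r v x) (bump_grad d r v y) \<le> 12 / r\<^sup>2 * Rd_dist d x y"
    if le: "Rd_dist d y v \<le> Rd_dist d x v" for x y
  proof (cases "Rd_dist d y v \<ge> r")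
    case True
    hence "bump_grad d r v x = bump_grad d r v y"
      using bump_outside(2)[OF assms] le by (metis order_trans)
    thus ?thesis by simp
  next
    case False
    define X Y where "X = Rd_dist d x v" and "Y = Rd_dist d y v"
    define W where "W t = max 0 (1 - (t / r)\<^sup>2)" for t
    have W: "0 \<le> W t" "W t \<le> 1" for t by (auto simp: W_def)
    have W_eq: "W t = 1 - t\<^sup>2 / r\<^sup>2" if "0 \<le> t" "t \<le> r" for t
    proof -
      have "(t / r)\<^sup>2 \<le> 1" using that assms by (intro power_le_one) auto
      thus ?thesis by (simp add: W_def power_divide)
    qed
    have XY: "0 \<le> Y" "Y \<le> X" "Y < r" "X - Y \<le> Rd_dist d x y"
      using False le Rd_dist_triangle[of d x v y] by (auto simp: X_def Y_def)
    have "W Y - W X \<le> 2 * (X - Y) / r"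
    proof (cases "X \<le> r")
      case True
      have "W Y - W X = (X\<^sup>2 - Y\<^sup>2) / r\<^sup>2"
        using XY True by (simp add: W_eq diff_divide_distrib)
      also have "X\<^sup>2 - Y\<^sup>2 = (X + Y) * (X - Y)" by (simp add: power2_eq_square algebra_simps)
      also have "\<dots> / r\<^sup>2 \<le> (2 * r) * (X - Y) / r\<^sup>2"
        using XY True assms by (intro divide_right_mono mult_right_mono) auto
      finally show ?thesis using assms by (simp add: power2_eq_square)
    next
      case False
      have "1 \<le> (X / r)\<^sup>2" using False assms by (intro one_le_power) auto
      hence "W X = 0" by (simp add: W_def)
      moreover have "W Y = (r\<^sup>2 - Y\<^sup>2) / r\<^sup>2"
        using XY assms by (simp add: W_eq diff_divide_distrib)
      moreover have "r\<^sup>2 - Y\<^sup>2 = (r + Y) * (r - Y)" by (simp add: power2_eq_square algebra_simps)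
      moreover have "(r + Y) * (r - Y) / r\<^sup>2 \<le> (2 * r) * (X - Y) / r\<^sup>2"
        using XY False assms by (intro divide_right_mono mult_mono) auto
      ultimately show ?thesis using assms by (simp add: power2_eq_square)
    qed
    moreover have "W X \<le> W Y"
      unfolding W_def using XY assms by (intro max.mono diff_mono power_mono divide_right_mono) auto
    ultimately have WW: "\<bar>W X - W Y\<bar> \<le> 2 * (X - Y) / r" by simp
    have "Rd_dist d (bump_grad d r v x) (bump_grad d r v y)
        = Rd_norm d (\<lambda>i. - 4 / r\<^sup>2 * (W X * (x i - y i) + (W X - W Y) * (y i - v i)))"
      unfolding Rd_dist_def
      by (intro Rd_norm_cong) (simp add: bump_grad_def W_def X_def Y_def Rd_dist_def algebra_simps diff_divide_distrib)
    also have "\<dots> = 4 / r\<^sup>2 * Rd_norm d (\<lambda>i. W X * (x i - y i) + (W X - W Y) * (y i - v i))"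
      unfolding Rd_norm_scale by simp
    also have "Rd_norm d (\<lambda>i. W X * (x i - y i) + (W X - W Y) * (y i - v i))
        \<le> Rd_norm d (\<lambda>i. W X * (x i - y i)) + Rd_norm d (\<lambda>i. (W X - W Y) * (y i - v i))"
      unfolding Rd_norm_def by (rule L2_set_triangle_ineq)
    also have "\<dots> = W X * Rd_dist d x y + \<bar>W X - W Y\<bar> * Y"
      unfolding Rd_norm_scale Rd_dist_def[symmetric] Y_def[symmetric] using W by simp
    also have "\<dots> \<le> 1 * Rd_dist d x y + (2 * (X - Y) / r) * r"
      using W WW XY assms by (intro add_mono mult_mono) auto
    also have "\<dots> = Rd_dist d x y + 2 * (X - Y)" using assms by simp
    also have "\<dots> \<le> 3 * Rd_dist d x y" using XY by simp
    finally show ?thesis using assms by (simp add: mult_left_mono field_simps)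
  qed
  show ?thesis
    using main[of y x] main[of x y] Rd_dist_commute by (metis linorder_linear)
qed

section \<open>Pitted basins: smoothness and locality\<close>

definition pitted :: "nat \<Rightarrow> real \<Rightarrow> real \<Rightarrow> real \<Rightarrow> real \<Rightarrow> point \<Rightarrow> point \<Rightarrow> real" where
  "pitted d \<kappa> \<epsilon> \<sigma> r v x = basin d \<kappa> \<epsilon> \<sigma> x - bump d r v x"

lemma smooth_basin:
  assumes "\<kappa> \<ge> 0" "\<epsilon> \<ge> 0" "\<sigma> > 0" "\<kappa> / \<sigma>\<^sup>2 \<le> L"
  shows "smooth d L (basin d \<kappa> \<epsilon> \<sigma>)"
proof (rule smoothI)
  fix x y
  show "Rd_dist d (basin_grad d \<kappa> \<epsilon> \<sigma> x) (basin_grad d \<kappa> \<epsilon> \<sigma> y) \<le> L * Rd_dist d x y"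
    using basin_grad_lipschitz[OF assms(1-3)] mult_right_mono[OF assms(4) Rd_dist_nonneg]
    by (rule order_trans)
qed (intro has_gradient_basin assms)

lemma smooth_pitted:
  assumes "\<kappa> \<ge> 0" "\<epsilon> \<ge> 0" "\<sigma> > 0" "r > 0" "\<kappa> / \<sigma>\<^sup>2 + 12 / r\<^sup>2 \<le> L"
  shows "smooth d L (pitted d \<kappa> \<epsilon> \<sigma> r v)"
  unfolding pitted_def[abs_def]
proof (rule smoothI)
  fix x y
  have "Rd_dist d (\<lambda>i\<in>{..<d}. basin_grad d \<kappa> \<epsilon> \<sigma> x i - bump_grad d r v x i)
      (\<lambda>i\<in>{..<d}. basin_grad d \<kappa> \<epsilon> \<sigma> y i - bump_grad d r v y i)
     \<le> \<kappa> / \<sigma>\<^sup>2 * Rd_dist d x y + 12 / r\<^sup>2 * Rd_dist d x y"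
    by (rule order_trans[OF Rd_dist_diff_le])
      (intro add_mono basin_grad_lipschitz bump_grad_lipschitz assms)
  also have "\<dots> \<le> L * Rd_dist d x y"
    using mult_right_mono[OF assms(5) Rd_dist_nonneg] by (simp add: distrib_right)
  finally show "Rd_dist d (\<lambda>i\<in>{..<d}. basin_grad d \<kappa> \<epsilon> \<sigma> x i - bump_grad d r v x i)
      (\<lambda>i\<in>{..<d}. basin_grad d \<kappa> \<epsilon> \<sigma> y i - bump_grad d r v y i) \<le> L * Rd_dist d x y" .
qed (intro has_gradient_diff has_gradient_basin has_gradient_bump assms)

text \<open>The sphere is included, so the answers can differ only in the open ball, and open balls
  are disjoint as soon as their centres are \<open>2 * r\<close> apart.\<close>

lemma pitted_outside:
  assumes "\<kappa> \<ge> 0" "\<epsilon> \<ge> 0" "\<sigma> > 0" "r > 0" "r \<le> Rd_dist d x v" "x \<in> Rd d"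
  shows "pitted d \<kappa> \<epsilon> \<sigma> r v x = basin d \<kappa> \<epsilon> \<sigma> x"
    "gradient d (pitted d \<kappa> \<epsilon> \<sigma> r v) x = gradient d (basin d \<kappa> \<epsilon> \<sigma>) x"
proof -
  show "pitted d \<kappa> \<epsilon> \<sigma> r v x = basin d \<kappa> \<epsilon> \<sigma> x"
    using bump_outside(1)[OF assms(4,5)] by (simp add: pitted_def)
  have "has_gradient d (pitted d \<kappa> \<epsilon> \<sigma> r v)
      (\<lambda>i\<in>{..<d}. basin_grad d \<kappa> \<epsilon> \<sigma> x i - bump_grad d r v x i) x"
    unfolding pitted_def[abs_def] by (intro has_gradient_diff has_gradient_basin has_gradient_bump assms)
  also have "(\<lambda>i\<in>{..<d}. basin_grad d \<kappa> \<epsilon> \<sigma> x i - bump_grad d r v x i) = basin_grad d \<kappa> \<epsilon> \<sigma> x"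
    unfolding bump_outside(2)[OF assms(4,5)] by (auto simp: basin_grad_def)
  finally show "gradient d (pitted d \<kappa> \<epsilon> \<sigma> r v) x = gradient d (basin d \<kappa> \<epsilon> \<sigma>) x"
    using gradient_eq[OF _ assms(6)] has_gradient_basin[OF assms(1-3)] by metis
qed

section \<open>Indistinguishable queries\<close>

text \<open>The premise concerns only the points queried on \<open>g\<close>: equal histories
  produce the same next query, so the run on \<open>f\<close> meets no other points.\<close>

lemma transcript_eq:
  assumes "\<And>j. j < k \<Longrightarrow> f (query d g A j) = g (query d g A j)
      \<and> gradient d f (query d g A j) = gradient d g (query d g A j)"
  shows "transcript d f A k = transcript d g A k"
  using assms
proof (induction k)
  case (Suc k)
  have "transcript d f A k = transcript d g A k" using Suc by simp
  thus ?case using Suc.prems[of k] by (simp add: query_def Let_def)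
qed simp

text \<open>Until the run on \<open>g\<close> enters \<open>B\<close>, both runs receive the same answers.\<close>

lemma query_hits_same_region:
  assumes "\<And>h. A h \<in> Rd d"
    and "\<And>x. x \<in> Rd d - B \<Longrightarrow> f x = g x \<and> gradient d f x = gradient d g x"
    and "k < K" "query d f A k \<in> B"
  shows "\<exists>j<K. query d g A j \<in> B"
proof (rule ccontr)
  assume none: "\<not> ?thesis"
  have "transcript d f A k = transcript d g A k"
    using none assms(1,2,3) by (intro transcript_eq) (auto simp: query_def)
  thus False using none assms(3,4) by (auto simp: query_def)
qed

text \<open>For a fixed seed the run on the reference \<open>f\<close> is one list of
  \<open>K\<close> points, each in at most one \<open>B v\<close>. So a seed succeeds for at most
  \<open>K\<close> of the functions, and averaging over the seeds bounds the sum of the success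
  probabilities by \<open>K\<close>.\<close>

lemma query_lower_bound:
  assumes alg: "randomized_algorithm d P A" and V: "finite V" and p: "p > 0"
    and guar: "\<And>v. v \<in> V \<Longrightarrow> guarantees d P A K p (F v)"
    and min: "\<And>v. v \<in> V \<Longrightarrow> minimizer d (F v) (z v)"
    and same: "\<And>v x. v \<in> V \<Longrightarrow> x \<in> Rd d - B v \<Longrightarrow> F v x = f x \<and> gradient d (F v) x = gradient d f x"
    and gap: "\<And>v x. v \<in> V \<Longrightarrow> x \<in> Rd d - B v \<Longrightarrow> F v (z v) + 1 \<le> F v x"
    and disj: "disjoint_family_on B V"
  shows "p * real (card V) \<le> real K"
proof -
  interpret prob_space P using alg by (simp add: randomized_algorithm_def)
  define E where "E v = {\<omega> \<in> space P. \<exists>k<K. \<bar>F v (query d (F v) (A \<omega>) k) - F v (z v)\<bar> < 1}" for v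
  have pE: "p \<le> prob (E v)" if "v \<in> V" for v
    using guar[OF that] min[OF that] by (auto simp: guarantees_def E_def)
  have E: "E v \<in> events" if "v \<in> V" for v
    using pE[OF that] p measure_notin_sets[of "E v" P] by force
  have hit: "\<exists>j<K. query d f (A \<omega>) j \<in> B v" if v: "v \<in> V" and \<omega>: "\<omega> \<in> E v" for v \<omega>
  proof -
    have A: "\<And>h. A \<omega> h \<in> Rd d" using alg \<omega> by (simp add: randomized_algorithm_def E_def)
    obtain k where k: "k < K" "\<bar>F v (query d (F v) (A \<omega>) k) - F v (z v)\<bar> < 1"
      using \<omega> by (auto simp: E_def)
    \<comment> \<open>By \<open>gap\<close>, a point outside \<open>B v\<close> misses the minimum
      by at least 1, whereas success demands less than 1.\<close>
    have "query d (F v) (A \<omega>) k \<in> B v"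
      using gap[OF v, of "query d (F v) (A \<omega>) k"] k(2) A by (force simp: query_def)
    thus ?thesis using same[OF v] A k(1) by (intro query_hits_same_region) auto
  qed
  have count: "(\<Sum>v\<in>V. indicat_real (E v) \<omega>) \<le> real K" for \<omega>
  proof -
    define H where "H = {v \<in> V. \<omega> \<in> E v}"
    \<comment> \<open>Each succeeding \<open>v\<close> is assigned a step of the reference run that
      lands in \<open>B v\<close>; disjointness makes the assignment injective.\<close>
    have "\<forall>v\<in>H. \<exists>j<K. query d f (A \<omega>) j \<in> B v" using hit by (auto simp: H_def)
    then obtain j where j: "\<And>v. v \<in> H \<Longrightarrow> j v < K \<and> query d f (A \<omega>) (j v) \<in> B v"
      by metis
    have "inj_on j H"
    proof (rule inj_onI)
      fix u v assume uv: "u \<in> H" "v \<in> H" "j u = j v"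
      show "u = v"
      proof (rule ccontr)
        assume "u \<noteq> v"
        hence "B u \<inter> B v = {}"
          using disj uv by (auto simp: disjoint_family_on_def H_def)
        thus False using j[OF uv(1)] j[OF uv(2)] uv(3) by auto
      qed
    qed
    moreover have "j ` H \<subseteq> {..<K}" using j by auto
    ultimately have "card H \<le> card {..<K}" by (intro card_inj_on_le) auto
    moreover have "(\<Sum>v\<in>V. indicat_real (E v) \<omega>) = real (card H)"
      using V by (simp add: H_def indicator_def sum.If_cases Int_def)
    ultimately show ?thesis by simp
  qed
  have "p * real (card V) = (\<Sum>v\<in>V. p)" by simp
  also have "\<dots> \<le> (\<Sum>v\<in>V. prob (E v))" by (intro sum_mono pE)
  also have "\<dots> = expectation (\<lambda>\<omega>. \<Sum>v\<in>V. indicat_real (E v) \<omega>)"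
    using E by (subst Bochner_Integration.integral_sum) (auto simp: integrable_indicator_iff emeasure_eq_measure)
  also have "\<dots> \<le> expectation (\<lambda>\<omega>. real K)"
    using E by (intro integral_mono count) (auto intro!: integrable_real_indicator simp: emeasure_eq_measure)
  also have "\<dots> = real K" by (simp add: prob_space)
  finally show ?thesis .
qed

text \<open>With \<open>K = 0\<close> the success event is empty. The existence of a minimizer
  matters: without one, \<open>guarantees\<close> holds vacuously.\<close>

lemma guarantees_imp_pos_queries:
  assumes "guarantees d P A K p f" "minimizer d f z" "p > 0"
  shows "K > 0"
proof (rule ccontr)
  assume "\<not> K > 0"
  hence "{\<omega> \<in> space P. \<exists>k<K. \<bar>f (query d f (A \<omega>) k) - f z\<bar> < 1} = {}" by simp
  thus False using assms by (auto simp: guarantees_def simp del: Collect_empty_eq)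
qed

section \<open>Volume and packing\<close>

interpretation lborel_PiM: product_sigma_finite "\<lambda>_::nat. lborel :: real measure" ..

lemma space_Rd_lborel: "space (Rd_lborel d) = Rd d"
  by (simp add: Rd_lborel_def Rd_def space_PiM)

lemma measurable_Rd_component [measurable]: "i < d \<Longrightarrow> (\<lambda>x. x i) \<in> borel_measurable (Rd_lborel d)"
  unfolding Rd_lborel_def by measurable

lemma borel_measurable_Rd_norm [measurable]: "Rd_norm d \<in> borel_measurable (Rd_lborel d)"
  unfolding Rd_norm_def[abs_def] L2_set_def
  by (intro measurable_compose[OF _ borel_measurable_sqrt] borel_measurable_sum borel_measurable_power measurable_Rd_component) auto

lemma borel_measurable_Rd_dist [measurable]: "(\<lambda>x. Rd_dist d x v) \<in> borel_measurable (Rd_lborel d)"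
  unfolding Rd_dist_def[abs_def] Rd_norm_def L2_set_def
  by (intro measurable_compose[OF _ borel_measurable_sqrt] borel_measurable_sum borel_measurable_power borel_measurable_diff
      measurable_Rd_component) auto

lemma borel_measurable_deadzone [measurable]: "deadzone \<epsilon> \<in> borel_measurable borel"
  unfolding deadzone_def[abs_def] by measurable

lemma borel_measurable_profile [measurable]: "profile \<kappa> \<epsilon> \<in> borel_measurable borel"
  unfolding profile_def[abs_def] by measurable

lemma borel_measurable_basin [measurable]: "basin d \<kappa> \<epsilon> \<sigma> \<in> borel_measurable (Rd_lborel d)"
  unfolding basin_def[abs_def]
  by (intro borel_measurable_sum measurable_compose[OF _ borel_measurable_profile]
      borel_measurable_divide measurable_Rd_component) auto

lemma borel_measurable_bump [measurable]: "bump d r v \<in> borel_measurable (Rd_lborel d)"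
  unfolding bump_def[abs_def] by measurable

lemma borel_measurable_pitted [measurable]: "pitted d \<kappa> \<epsilon> \<sigma> r v \<in> borel_measurable (Rd_lborel d)"
  unfolding pitted_def[abs_def] by measurable

lemma nn_integral_gaussian:
  assumes "s > 0"
  shows "(\<integral>\<^sup>+x. ennreal (exp (- (x - m)\<^sup>2 / (2 * s\<^sup>2))) \<partial>lborel) = ennreal (sqrt (2 * pi) * s)"
proof -
  have eq: "exp (- (x - m)\<^sup>2 / (2 * s\<^sup>2)) = (sqrt (2 * pi) * s) * normal_density m s x" for x
    using assms by (simp add: normal_density_def real_sqrt_mult)
  have "(\<integral>\<^sup>+x. ennreal (exp (- (x - m)\<^sup>2 / (2 * s\<^sup>2))) \<partial>lborel)
     = ennreal (\<integral>x. (sqrt (2 * pi) * s) * normal_density m s x \<partial>lborel)"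
    unfolding eq using assms by (intro nn_integral_eq_integral) auto
  thus ?thesis using assms by simp
qed

text \<open>The minimum over \<open>s > 0\<close> of
  \<open>exp (r^2 / (2 * s^2)) * (sqrt (2 * pi) * s) ^ d\<close>. By Stirling it exceeds the volume
  of the ball only by a factor of order \<open>sqrt d\<close>, and being a pure \<open>d\<close>-th
  power it compares with a cube through the side length.\<close>

definition ball_bound :: "nat \<Rightarrow> real \<Rightarrow> real" where
  "ball_bound d r = (sqrt (2 * pi * exp 1) * r / sqrt (real d)) ^ d"

lemma ball_bound_pos: "r > 0 \<Longrightarrow> d > 0 \<Longrightarrow> ball_bound d r > 0"
  by (simp add: ball_bound_def)

text \<open>Chernoff bound: the indicator of the ball is dominated by a Gaussian of variance \<open>r\<^sup>2 / d\<close>.\<close>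

lemma emeasure_ball_le:
  assumes "r > 0" "d > 0"
  shows "emeasure (Rd_lborel d) {x \<in> Rd d. Rd_dist d x v \<le> r} \<le> ennreal (ball_bound d r)"
proof -
  define s where "s = r / sqrt (real d)"
  have s: "s > 0" "s\<^sup>2 = r\<^sup>2 / d" using assms by (auto simp: s_def power_divide)
  have meas: "{x \<in> Rd d. Rd_dist d x v \<le> r} \<in> sets (Rd_lborel d)"
    unfolding space_Rd_lborel[symmetric] by measurable
  have "indicator {x \<in> Rd d. Rd_dist d x v \<le> r} x
      \<le> ennreal (exp (d / 2)) * (\<Prod>i<d. ennreal (exp (- (x i - v i)\<^sup>2 / (2 * s\<^sup>2))))" for x
  proof (cases "x \<in> Rd d \<and> Rd_dist d x v \<le> r")
    case True
    have "(Rd_dist d x v)\<^sup>2 \<le> r\<^sup>2" using True by (intro power_mono) auto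
    hence "(Rd_dist d x v)\<^sup>2 / (2 * s\<^sup>2) \<le> r\<^sup>2 / (2 * s\<^sup>2)" by (intro divide_right_mono) auto
    also have "r\<^sup>2 / (2 * s\<^sup>2) = d / 2" using assms by (simp add: s(2))
    finally have "0 \<le> d / 2 - (Rd_dist d x v)\<^sup>2 / (2 * s\<^sup>2)" by simp
    hence "1 \<le> exp (d / 2 - (Rd_dist d x v)\<^sup>2 / (2 * s\<^sup>2))" by simp
    also have "\<dots> = exp (d / 2) * (\<Prod>i<d. exp (- (x i - v i)\<^sup>2 / (2 * s\<^sup>2)))"
      by (simp add: exp_sum[symmetric] Rd_dist_sq exp_add[symmetric] sum_negf sum_divide_distrib)
    finally have "ennreal 1 \<le> ennreal \<dots>" by (rule ennreal_leI)
    thus ?thesis using True by (simp add: prod_ennreal ennreal_mult prod_nonneg)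
  qed auto
  hence "emeasure (Rd_lborel d) {x \<in> Rd d. Rd_dist d x v \<le> r}
     \<le> (\<integral>\<^sup>+x. ennreal (exp (d / 2)) * (\<Prod>i<d. ennreal (exp (- (x i - v i)\<^sup>2 / (2 * s\<^sup>2)))) \<partial>Rd_lborel d)"
    by (subst nn_integral_indicator[OF meas, symmetric]) (intro nn_integral_mono, auto)
  also have "\<dots> = ennreal (exp (d / 2)) *
      (\<integral>\<^sup>+x. (\<Prod>i<d. ennreal (exp (- (x i - v i)\<^sup>2 / (2 * s\<^sup>2)))) \<partial>Rd_lborel d)"
    by (intro nn_integral_cmult borel_measurable_prod_ennreal measurable_compose[OF _ measurable_ennreal])
      auto
  also have "(\<integral>\<^sup>+x. (\<Prod>i<d. ennreal (exp (- (x i - v i)\<^sup>2 / (2 * s\<^sup>2)))) \<partial>Rd_lborel d)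
      = (\<Prod>i<d. \<integral>\<^sup>+t. ennreal (exp (- (t - v i)\<^sup>2 / (2 * s\<^sup>2))) \<partial>lborel)"
    unfolding Rd_lborel_def by (rule lborel_PiM.product_nn_integral_prod) auto
  also have "\<dots> = ennreal ((sqrt (2 * pi) * s) ^ d)"
    unfolding nn_integral_gaussian[OF s(1)] using s(1) by (simp add: ennreal_power)
  also have "ennreal (exp (d / 2)) * \<dots> = ennreal (exp (d / 2) * (sqrt (2 * pi) * s) ^ d)"
    using s(1) by (simp add: ennreal_mult)
  also have "exp (real d / 2) = sqrt (exp 1) ^ d"
  proof -
    have "sqrt (exp 1) = exp (1 / 2 :: real)"
      by (rule real_sqrt_unique) (simp_all add: power2_eq_square exp_add[symmetric])
    thus ?thesis by (simp add: exp_of_nat_mult[symmetric])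
  qed
  also have "sqrt (exp 1) ^ d * (sqrt (2 * pi) * s) ^ d = ball_bound d r"
    by (simp add: ball_bound_def s_def power_mult_distrib[symmetric] real_sqrt_mult mult_ac)
  finally show ?thesis .
qed

section \<open>Packing a cube\<close>

definition cube :: "nat \<Rightarrow> real \<Rightarrow> point set" where
  "cube d \<rho> = {..<d} \<rightarrow>\<^sub>E {-\<rho>..\<rho>}"

lemma emeasure_cube: "\<rho> \<ge> 0 \<Longrightarrow> emeasure (Rd_lborel d) (cube d \<rho>) = ennreal ((2 * \<rho>) ^ d)"
  unfolding Rd_lborel_def cube_def
  by (subst lborel_PiM.emeasure_PiM) (auto simp: ennreal_power)

lemma cube_subset_Rd: "cube d \<rho> \<subseteq> Rd d"
  by (auto simp: cube_def Rd_def)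

text \<open>Greedy choice: as long as the balls about the chosen points are too small in volume to
  cover the cube, a further point exists. For \<open>n\<close> points only \<open>n - 1\<close>
  balls must fail to cover, hence the extra \<open>ball_bound d r\<close> on the right.\<close>

lemma exists_separated_points:
  assumes "r > 0" "d > 0" "\<rho> > 0" "real n * ball_bound d r < (2 * \<rho>) ^ d + ball_bound d r"
  shows "\<exists>V. finite V \<and> card V = n \<and> V \<subseteq> cube d \<rho> \<and> (\<forall>u\<in>V. \<forall>v\<in>V. u \<noteq> v \<longrightarrow> r < Rd_dist d u v)"
  using assms(4)
proof (induction n)
  case 0
  show ?case by (intro exI[of _ "{}"]) auto
next
  case (Suc n)
  let ?b = "ball_bound d r"
  have b: "?b > 0" using assms by (intro ball_bound_pos)
  have n: "real n * ?b < (2 * \<rho>) ^ d" using Suc.prems by (simp add: distrib_right)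
  then obtain V where V: "finite V" "card V = n" "V \<subseteq> cube d \<rho>"
      "\<forall>u\<in>V. \<forall>v\<in>V. u \<noteq> v \<longrightarrow> r < Rd_dist d u v"
    using Suc.IH b by fastforce
  define U where "U = (\<Union>v\<in>V. {x \<in> Rd d. Rd_dist d x v \<le> r})"
  have meas: "{x \<in> Rd d. Rd_dist d x v \<le> r} \<in> sets (Rd_lborel d)" for v
    unfolding space_Rd_lborel[symmetric] by measurable
  have "\<not> cube d \<rho> \<subseteq> U"
  proof
    assume "cube d \<rho> \<subseteq> U"
    hence "ennreal ((2 * \<rho>) ^ d) \<le> emeasure (Rd_lborel d) U"
      using V(1) meas assms(3) by (subst emeasure_cube[symmetric]) (auto intro!: emeasure_mono simp: U_def)
    also have "\<dots> \<le> (\<Sum>v\<in>V. emeasure (Rd_lborel d) {x \<in> Rd d. Rd_dist d x v \<le> r})"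
      unfolding U_def using V(1) meas by (intro emeasure_subadditive_finite) auto
    also have "\<dots> \<le> (\<Sum>v\<in>V. ennreal ?b)"
      by (intro sum_mono emeasure_ball_le assms)
    also have "\<dots> = ennreal (real n * ?b)"
      using b by (simp add: V(2) ennreal_mult ennreal_of_nat_eq_real_of_nat)
    finally show False using n assms b by (subst (asm) ennreal_le_iff) auto
  qed
  then obtain x where x: "x \<in> cube d \<rho>" "x \<notin> U" by auto
  have far: "r < Rd_dist d x v" if "v \<in> V" for v
    using x that cube_subset_Rd by (force simp: U_def)
  have "x \<notin> V" using far[of x] assms(1) by auto
  thus ?case
    using V x far by (intro exI[of _ "insert x V"]) (auto simp: Rd_dist_commute)
qed

section \<open>Second moments\<close>

text \<open>A lower bound free of \<open>\<epsilon>\<close>: it provides one Gaussian majorant for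
  all profiles with \<open>\<epsilon> \<le> 1\<close>, as dominated convergence requires.\<close>

lemma deadzone_sq_ge: "0 \<le> \<epsilon> \<Longrightarrow> \<epsilon> \<le> 1 \<Longrightarrow> t\<^sup>2 / 2 - 1 \<le> (deadzone \<epsilon> t)\<^sup>2"
proof -
  assume \<epsilon>: "0 \<le> \<epsilon>" "\<epsilon> \<le> 1"
  have "\<bar>t\<bar> \<le> \<bar>deadzone \<epsilon> t\<bar> + 1"
    using \<epsilon> unfolding deadzone_def by (auto simp: max_def min_def abs_if)
  hence "t\<^sup>2 \<le> (\<bar>deadzone \<epsilon> t\<bar> + 1)\<^sup>2"
    by (metis abs_ge_zero power2_abs power_mono)
  moreover have "0 \<le> (\<bar>deadzone \<epsilon> t\<bar> - 1)\<^sup>2" by simp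
  ultimately show ?thesis by (simp add: power2_sum power2_diff)
qed

lemma profile_moment_tendsto:
  fixes \<kappa> :: real and j :: nat
  assumes "\<kappa> > 0"
  shows "(\<lambda>n. \<integral>u. u ^ (2 * j) * exp (- profile \<kappa> (1 / real (Suc n)) u) \<partial>lborel)
      \<longlonglongrightarrow> (\<integral>u. u ^ (2 * j) * exp (- \<kappa> / 2 * u\<^sup>2) \<partial>lborel)" (is ?lim)
    and "0 \<le> \<epsilon> \<Longrightarrow> \<epsilon> \<le> 1 \<Longrightarrow> integrable lborel (\<lambda>u. u ^ (2 * j) * exp (- profile \<kappa> \<epsilon> u))"
proof -
  \<comment> \<open>Variance \<open>2 / \<kappa>\<close> matches the decay
    \<open>exp (- \<kappa> / 4 * u^2)\<close> left by \<open>deadzone_sq_ge\<close>; the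
    \<open>- 1\<close> there becomes the factor \<open>exp (\<kappa> / 2)\<close>.\<close>
  define \<tau> where "\<tau> = sqrt (2 / \<kappa>)"
  have \<tau>: "\<tau> > 0" "\<tau>\<^sup>2 = 2 / \<kappa>" using assms by (auto simp: \<tau>_def)
  define w where "w u = exp (\<kappa> / 2) * sqrt (2 * pi * \<tau>\<^sup>2) * (normal_density 0 \<tau> u * (u - 0) ^ (2 * j))" for u
  have w: "integrable lborel w"
    unfolding w_def using \<tau>(1) by (intro integrable_mult_right integrable_normal_moment)
  have w_eq: "w u = u ^ (2 * j) * exp (\<kappa> / 2 - \<kappa> / 4 * u\<^sup>2)" for u
  proof -
    have "\<kappa> / 4 * u\<^sup>2 = (u - 0)\<^sup>2 / (2 * \<tau>\<^sup>2)" using assms by (simp add: \<tau>(2) field_simps)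
    hence "exp (\<kappa> / 2 - \<kappa> / 4 * u\<^sup>2) = exp (\<kappa> / 2) * exp (- (u - 0)\<^sup>2 / (2 * \<tau>\<^sup>2))"
      by (simp add: exp_add[symmetric])
    thus ?thesis using \<tau>(1) by (simp add: w_def normal_density_def)
  qed
  have bound: "norm (u ^ (2 * j) * exp (- profile \<kappa> \<epsilon> u)) \<le> w u" if "0 \<le> \<epsilon>" "\<epsilon> \<le> 1" for \<epsilon> u :: real
  proof -
    have "\<kappa> / 2 * (u\<^sup>2 / 2 - 1) \<le> profile \<kappa> \<epsilon> u"
      unfolding profile_def using assms deadzone_sq_ge[OF that] by (intro mult_left_mono) auto
    hence "- profile \<kappa> \<epsilon> u \<le> \<kappa> / 2 - \<kappa> / 4 * u\<^sup>2" by (simp add: algebra_simps)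
    thus ?thesis unfolding w_eq by (simp add: abs_mult power_even_abs mult_left_mono)
  qed
  show "integrable lborel (\<lambda>u. u ^ (2 * j) * exp (- profile \<kappa> \<epsilon> u))" if "0 \<le> \<epsilon>" "\<epsilon> \<le> 1"
    using w by (rule Bochner_Integration.integrable_bound)
      (use bound[OF that] in \<open>auto intro!: AE_I2 intro: order_trans[OF _ abs_ge_self]\<close>)
  have ptw: "(\<lambda>n. u ^ (2 * j) * exp (- profile \<kappa> (1 / real (Suc n)) u))
      \<longlonglongrightarrow> u ^ (2 * j) * exp (- \<kappa> / 2 * u\<^sup>2)" for u
  proof -
    have e: "(\<lambda>n. 1 / real (Suc n)) \<longlonglongrightarrow> 0"
      using LIMSEQ_inverse_real_of_nat by (simp add: inverse_eq_divide)
    have "(\<lambda>n. u ^ (2 * j) * exp (- profile \<kappa> (1 / real (Suc n)) u))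
        \<longlonglongrightarrow> u ^ (2 * j) * exp (- (\<kappa> / 2 * (u - max (- 0) (min 0 u))\<^sup>2))"
      unfolding profile_def deadzone_def by (intro tendsto_intros e)
    thus ?thesis by simp
  qed
  show ?lim
    by (rule integral_dominated_convergence[OF _ _ w]) (use ptw bound in \<open>auto intro!: AE_I2\<close>)
qed

lemma gaussian_integrals:
  assumes "\<kappa> > 0"
  shows "(\<integral>u. exp (- \<kappa> / 2 * u\<^sup>2) \<partial>lborel) = sqrt (2 * pi / \<kappa>)"
    and "(\<integral>u. u\<^sup>2 * exp (- \<kappa> / 2 * u\<^sup>2) \<partial>lborel) = sqrt (2 * pi / \<kappa>) / \<kappa>"
proof -
  define s where "s = sqrt (1 / \<kappa>)"
  have s: "s > 0" "s\<^sup>2 = 1 / \<kappa>" using assms by (auto simp: s_def)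
  have eq: "exp (- \<kappa> / 2 * u\<^sup>2) = sqrt (2 * pi / \<kappa>) * normal_density 0 s u" for u
    using assms by (simp add: normal_density_def s(2))
  show "(\<integral>u. exp (- \<kappa> / 2 * u\<^sup>2) \<partial>lborel) = sqrt (2 * pi / \<kappa>)"
    unfolding eq using s(1) by simp
  have "(\<integral>u. u\<^sup>2 * exp (- \<kappa> / 2 * u\<^sup>2) \<partial>lborel)
      = (\<integral>u. sqrt (2 * pi / \<kappa>) * (normal_density 0 s u * (u - 0) ^ (2 * 1)) \<partial>lborel)"
    unfolding eq by (intro Bochner_Integration.integral_cong) (auto simp: mult_ac)
  also have "\<dots> = sqrt (2 * pi / \<kappa>) * s\<^sup>2"
    unfolding integral_mult_right_zero integral_normal_moment_even[OF s(1)] by simp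
  finally show "(\<integral>u. u\<^sup>2 * exp (- \<kappa> / 2 * u\<^sup>2) \<partial>lborel) = sqrt (2 * pi / \<kappa>) / \<kappa>"
    by (simp add: s(2))
qed

text \<open>As \<open>\<epsilon>\<close> tends to 0, \<open>m / z\<close> tends to the Gaussian
  variance \<open>1 / \<kappa>\<close>, which lies strictly between \<open>a\<close> and
  \<open>b\<close>, so a small \<open>\<epsilon>\<close> works. The bound
  \<open>2 * \<epsilon> \<le> z\<close> later compares the cube with the normalising
  integral.\<close>

lemma exists_profile:
  fixes a b \<kappa> :: real
  assumes "\<kappa> > 0" "a < 1 / \<kappa>" "1 / \<kappa> < b"
  obtains \<epsilon> z m where "\<epsilon> > 0" "2 * \<epsilon> \<le> z" "a * z < m" "m < b * z"
    "(\<integral>\<^sup>+u. ennreal (exp (- profile \<kappa> \<epsilon> u)) \<partial>lborel) = ennreal z"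
    "(\<integral>\<^sup>+u. ennreal (u\<^sup>2 * exp (- profile \<kappa> \<epsilon> u)) \<partial>lborel) = ennreal m"
proof -
  define Z where "Z \<epsilon> = (\<integral>u. exp (- profile \<kappa> \<epsilon> u) \<partial>lborel)" for \<epsilon>
  define m where "m \<epsilon> = (\<integral>u. u\<^sup>2 * exp (- profile \<kappa> \<epsilon> u) \<partial>lborel)" for \<epsilon>
  define e where "e n = 1 / real (Suc n)" for n
  define q where "q = sqrt (2 * pi / \<kappa>)"
  have q: "q > 0" using assms by (simp add: q_def)
  have Z: "(\<lambda>n. Z (e n)) \<longlonglongrightarrow> q"
    using profile_moment_tendsto(1)[OF assms(1), of 0] gaussian_integrals(1)[OF assms(1)]
    by (simp add: Z_def e_def q_def)
  have m: "(\<lambda>n. m (e n)) \<longlonglongrightarrow> q / \<kappa>"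
    using profile_moment_tendsto(1)[OF assms(1), of 1] gaussian_integrals(2)[OF assms(1)]
    by (simp add: m_def e_def q_def)
  have "(\<lambda>n. m (e n) - a * Z (e n)) \<longlonglongrightarrow> q / \<kappa> - a * q" by (intro tendsto_intros Z m)
  moreover have "q / \<kappa> - a * q > 0" using mult_strict_right_mono[OF assms(2) q] by simp
  ultimately have ev1: "\<forall>\<^sub>F n in sequentially. m (e n) - a * Z (e n) > 0" by (rule order_tendstoD)
  have "(\<lambda>n. b * Z (e n) - m (e n)) \<longlonglongrightarrow> b * q - q / \<kappa>" by (intro tendsto_intros Z m)
  moreover have "b * q - q / \<kappa> > 0" using mult_strict_right_mono[OF assms(3) q] by simp
  ultimately have "\<forall>\<^sub>F n in sequentially. b * Z (e n) - m (e n) > 0" by (rule order_tendstoD)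
  from eventually_conj[OF ev1 this] obtain n where n: "m (e n) - a * Z (e n) > 0" "b * Z (e n) - m (e n) > 0"
    by (auto simp: eventually_sequentially)
  have e: "0 < e n" "e n \<le> 1" by (auto simp: e_def)
  have i0: "integrable lborel (\<lambda>u. exp (- profile \<kappa> (e n) u))"
    using profile_moment_tendsto(2)[OF assms(1), of "e n" 0] e by simp
  have i1: "integrable lborel (\<lambda>u. u\<^sup>2 * exp (- profile \<kappa> (e n) u))"
    using profile_moment_tendsto(2)[OF assms(1), of "e n" 1] e by simp
  \<comment> \<open>The integrand is 1 on the flat part.\<close>
  have "2 * e n = measure lborel {- e n..e n}" using e by simp
  also have "\<dots> = (\<integral>u. indicat_real {- e n..e n} u \<partial>lborel)" by simp
  also have "\<dots> \<le> Z (e n)"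
    unfolding Z_def
  proof (rule integral_mono)
    show "indicat_real {- e n..e n} u \<le> exp (- profile \<kappa> (e n) u)" for u
      using deadzone_eq_0_iff[of "e n" u] e by (auto simp: profile_def indicator_def abs_le_iff)
  qed (use i0 in \<open>auto intro!: integrable_real_indicator simp: emeasure_lborel_Icc_eq\<close>)
  finally have "2 * e n \<le> Z (e n)" .
  with n e show ?thesis
    by (intro that[of "e n" "Z (e n)" "m (e n)"])
      (auto simp: Z_def m_def nn_integral_eq_integral i0 i1)
qed

text \<open>Substitute \<open>t = \<sigma> * u\<close>: one factor \<open>\<sigma>\<close> comes
  from the line element, two more from \<open>t^2\<close>.\<close>

lemma nn_integral_scaled_profile:
  assumes "\<sigma> > 0" "z \<ge> 0" "m \<ge> 0"
    "(\<integral>\<^sup>+u. ennreal (exp (- profile \<kappa> \<epsilon> u)) \<partial>lborel) = ennreal z"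
    "(\<integral>\<^sup>+u. ennreal (u\<^sup>2 * exp (- profile \<kappa> \<epsilon> u)) \<partial>lborel) = ennreal m"
  shows "(\<integral>\<^sup>+t. ennreal (exp (- profile \<kappa> \<epsilon> (t / \<sigma>))) \<partial>lborel) = ennreal (\<sigma> * z)"
    and "(\<integral>\<^sup>+t. ennreal (t\<^sup>2 * exp (- profile \<kappa> \<epsilon> (t / \<sigma>))) \<partial>lborel) = ennreal (\<sigma> ^ 3 * m)"
proof -
  show "(\<integral>\<^sup>+t. ennreal (exp (- profile \<kappa> \<epsilon> (t / \<sigma>))) \<partial>lborel) = ennreal (\<sigma> * z)"
    using assms by (subst nn_integral_real_affine[where c = \<sigma> and t = 0]) (auto simp: ennreal_mult)
  have "(\<integral>\<^sup>+t. ennreal (t\<^sup>2 * exp (- profile \<kappa> \<epsilon> (t / \<sigma>))) \<partial>lborel)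
      = ennreal \<sigma> * (\<integral>\<^sup>+u. ennreal (\<sigma>\<^sup>2) * ennreal (u\<^sup>2 * exp (- profile \<kappa> \<epsilon> u)) \<partial>lborel)"
    using assms(1) by (subst nn_integral_real_affine[where c = \<sigma> and t = 0])
      (auto simp: ennreal_mult[symmetric] power_mult_distrib mult.assoc)
  also have "\<dots> = ennreal (\<sigma> ^ 3 * m)"
    using assms by (subst nn_integral_cmult) (auto simp: ennreal_mult[symmetric] power3_eq_cube power2_eq_square mult.assoc)
  finally show "(\<integral>\<^sup>+t. ennreal (t\<^sup>2 * exp (- profile \<kappa> \<epsilon> (t / \<sigma>))) \<partial>lborel) = ennreal (\<sigma> ^ 3 * m)" .
qed

lemma nn_integral_basin:
  assumes "\<sigma> > 0" "z > 0" "m \<ge> 0"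
    "(\<integral>\<^sup>+u. ennreal (exp (- profile \<kappa> \<epsilon> u)) \<partial>lborel) = ennreal z"
    "(\<integral>\<^sup>+u. ennreal (u\<^sup>2 * exp (- profile \<kappa> \<epsilon> u)) \<partial>lborel) = ennreal m"
  shows "(\<integral>\<^sup>+x. ennreal (exp (- basin d \<kappa> \<epsilon> \<sigma> x)) \<partial>Rd_lborel d) = ennreal ((\<sigma> * z) ^ d)"
    and "(\<integral>\<^sup>+x. ennreal ((Rd_norm d x)\<^sup>2 * exp (- basin d \<kappa> \<epsilon> \<sigma> x)) \<partial>Rd_lborel d)
      = ennreal (d * \<sigma>\<^sup>2 * (m / z) * (\<sigma> * z) ^ d)"
proof -
  note scaled = nn_integral_scaled_profile[OF assms(1) less_imp_le[OF assms(2)] assms(3-5)]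
  let ?g = "\<lambda>t. exp (- profile \<kappa> \<epsilon> (t / \<sigma>))"
  have eq: "exp (- basin d \<kappa> \<epsilon> \<sigma> x) = (\<Prod>i<d. ?g (x i))" for x
    by (simp add: basin_def exp_sum[symmetric] sum_negf)
  show "(\<integral>\<^sup>+x. ennreal (exp (- basin d \<kappa> \<epsilon> \<sigma> x)) \<partial>Rd_lborel d) = ennreal ((\<sigma> * z) ^ d)"
    unfolding eq Rd_lborel_def prod_ennreal[OF exp_ge_zero, symmetric]
    by (subst lborel_PiM.product_nn_integral_prod) (use scaled assms in \<open>auto simp: ennreal_power\<close>)
  \<comment> \<open>Only coordinate \<open>j\<close> carries the factor \<open>t^2\<close>. Thus the
    squared norm times the density is a sum of \<open>d\<close> products, and the integral of each
    factorises.\<close>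
  let ?h = "\<lambda>j i t. if i = j then t\<^sup>2 * ?g t else ?g t"
  have h: "ennreal ((Rd_norm d x)\<^sup>2 * exp (- basin d \<kappa> \<epsilon> \<sigma> x)) = (\<Sum>j<d. \<Prod>i<d. ennreal (?h j i (x i)))" for x
  proof -
    have h1: "(\<Prod>i<d. ?h j i (x i)) = (x j)\<^sup>2 * (\<Prod>i<d. ?g (x i))" if "j < d" for j
      using that by (simp add: prod.remove[of "{..<d}" j] mult.assoc)
    have h2: "(Rd_norm d x)\<^sup>2 * exp (- basin d \<kappa> \<epsilon> \<sigma> x) = (\<Sum>j<d. \<Prod>i<d. ?h j i (x i))"
      unfolding Rd_norm_sq eq sum_distrib_right by (intro sum.cong refl h1[symmetric]) simp
    have "ennreal ((Rd_norm d x)\<^sup>2 * exp (- basin d \<kappa> \<epsilon> \<sigma> x))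
        = (\<Sum>j<d. ennreal (\<Prod>i<d. ?h j i (x i)))"
      unfolding h2 by (intro sum_ennreal[symmetric] prod_nonneg) auto
    also have "\<dots> = (\<Sum>j<d. \<Prod>i<d. ennreal (?h j i (x i)))"
      by (rule sum.cong[OF refl], rule prod_ennreal[symmetric]) auto
    finally show ?thesis .
  qed
  have "(\<integral>\<^sup>+x. (\<Prod>i<d. ennreal (?h j i (x i))) \<partial>Rd_lborel d) = ennreal (\<sigma>\<^sup>2 * (m / z) * (\<sigma> * z) ^ d)"
    if j: "j < d" for j
  proof -
    have "(\<integral>\<^sup>+x. (\<Prod>i<d. ennreal (?h j i (x i))) \<partial>Rd_lborel d)
        = (\<Prod>i<d. \<integral>\<^sup>+t. ennreal (?h j i t) \<partial>lborel)"
      unfolding Rd_lborel_def by (rule lborel_PiM.product_nn_integral_prod) auto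
    also have "\<dots> = (\<Prod>i<d. if i = j then ennreal (\<sigma> ^ 3 * m) else ennreal (\<sigma> * z))"
      using scaled by (intro prod.cong) auto
    also have "\<dots> = ennreal (\<sigma> ^ 3 * m) * ennreal (\<sigma> * z) ^ (d - 1)"
      using j by (simp add: prod.remove[of "{..<d}" j])
    also have "\<dots> = ennreal (\<sigma> ^ 3 * m * (\<sigma> * z) ^ (d - 1))"
      using assms by (simp add: ennreal_power ennreal_mult[symmetric])
    also have "\<sigma> ^ 3 * m * (\<sigma> * z) ^ (d - 1) = \<sigma>\<^sup>2 * (m / z) * (\<sigma> * z) ^ d"
      using j assms by (cases d) (auto simp: power3_eq_cube power2_eq_square)
    finally show ?thesis .
  qed
  hence "(\<Sum>j<d. \<integral>\<^sup>+x. (\<Prod>i<d. ennreal (?h j i (x i))) \<partial>Rd_lborel d)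
      = ennreal (d * \<sigma>\<^sup>2 * (m / z) * (\<sigma> * z) ^ d)"
    using assms by (simp add: ennreal_of_nat_eq_real_of_nat ennreal_mult[symmetric] mult.assoc)
  moreover have "(\<lambda>x. \<Prod>i<d. ennreal (?h j i (x i))) \<in> borel_measurable (Rd_lborel d)" for j
    by (intro borel_measurable_prod_ennreal) (auto intro!: measurable_compose[OF measurable_Rd_component])
  ultimately show "(\<integral>\<^sup>+x. ennreal ((Rd_norm d x)\<^sup>2 * exp (- basin d \<kappa> \<epsilon> \<sigma> x)) \<partial>Rd_lborel d)
      = ennreal (d * \<sigma>\<^sup>2 * (m / z) * (\<sigma> * z) ^ d)"
    unfolding h by (subst nn_integral_sum) auto
qed

text \<open>Stated with brackets to cover both families: for a basin the two sides coincide, for a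
  pitted basin they leave slack.\<close>

lemma second_moment_gibbs_bounds:
  assumes [measurable]: "f \<in> borel_measurable (Rd_lborel d)"
    and Z: "0 < Z1" "ennreal Z1 \<le> (\<integral>\<^sup>+x. ennreal (exp (- f x)) \<partial>Rd_lborel d)"
      "(\<integral>\<^sup>+x. ennreal (exp (- f x)) \<partial>Rd_lborel d) \<le> ennreal Z2"
    and N: "0 \<le> N1" "ennreal N1 \<le> (\<integral>\<^sup>+x. ennreal ((Rd_norm d x)\<^sup>2 * exp (- f x)) \<partial>Rd_lborel d)"
      "(\<integral>\<^sup>+x. ennreal ((Rd_norm d x)\<^sup>2 * exp (- f x)) \<partial>Rd_lborel d) \<le> ennreal N2"
  shows "integrable (Rd_lborel d) (\<lambda>x. exp (- f x))"
    and "ennreal (N1 / Z2) \<le> second_moment d (gibbs d f)"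
    and "second_moment d (gibbs d f) \<le> ennreal (N2 / Z1)"
proof -
  let ?Z = "\<integral>x. exp (- f x) \<partial>Rd_lborel d"
  show int: "integrable (Rd_lborel d) (\<lambda>x. exp (- f x))"
    using Z(3) by (intro integrableI_nonneg) (auto simp: less_top intro: order_le_less_trans)
  hence Zeq: "(\<integral>\<^sup>+x. ennreal (exp (- f x)) \<partial>Rd_lborel d) = ennreal ?Z"
    by (intro nn_integral_eq_integral) auto
  have Z0: "0 \<le> ?Z" by simp
  have Z1: "Z1 \<le> ?Z" using Z(2) Z0 unfolding Zeq by (simp add: ennreal_le_iff)
  hence Zpos: "0 < ?Z" using Z(1) by linarith
  have Z2: "?Z \<le> Z2"
    using Z(3) Zpos unfolding Zeq by (metis ennreal_le_iff2 not_le)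
  obtain n where n: "(\<integral>\<^sup>+x. ennreal ((Rd_norm d x)\<^sup>2 * exp (- f x)) \<partial>Rd_lborel d) = ennreal n" "n \<ge> 0"
    using N(3) by (cases "\<integral>\<^sup>+x. ennreal ((Rd_norm d x)\<^sup>2 * exp (- f x)) \<partial>Rd_lborel d")
      (auto simp: top_unique)
  \<comment> \<open>\<open>ennreal\<close> truncates at 0, so if \<open>N2\<close> is negative its
    bound says only \<open>n = 0\<close>.\<close>
  have n12: "N1 \<le> n" "n \<le> N2 \<or> n = 0" using N n by (auto simp: ennreal_le_iff2)
  have "second_moment d (gibbs d f)
      = (\<integral>\<^sup>+x. ennreal (exp (- f x) / ?Z) * ennreal ((Rd_norm d x)\<^sup>2) \<partial>Rd_lborel d)"
    unfolding second_moment_def gibbs_def by (subst nn_integral_density) auto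
  also have "\<dots> = (\<integral>\<^sup>+x. ennreal (1 / ?Z) * ennreal ((Rd_norm d x)\<^sup>2 * exp (- f x)) \<partial>Rd_lborel d)"
    using Zpos by (intro nn_integral_cong) (simp add: ennreal_mult[symmetric] mult.commute)
  also have "\<dots> = ennreal (1 / ?Z) * ennreal n"
    unfolding n(1)[symmetric] by (rule nn_integral_cmult) auto
  also have "\<dots> = ennreal (n / ?Z)" using Zpos n by (simp add: ennreal_mult[symmetric])
  finally have eq: "second_moment d (gibbs d f) = ennreal (n / ?Z)" .
  show "ennreal (N1 / Z2) \<le> second_moment d (gibbs d f)"
    unfolding eq using n12 Z1 Z2 Zpos N(1) n by (intro ennreal_leI frac_le) auto
  show "second_moment d (gibbs d f) \<le> ennreal (N2 / Z1)"
  proof (cases "n = 0")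
    case False
    thus ?thesis unfolding eq using n12 Z1 Zpos Z(1) n by (intro ennreal_leI frac_le) auto
  qed (simp add: eq)
qed

lemma gibbs_basin:
  assumes "\<sigma> > 0" "z > 0" "m \<ge> 0"
    "(\<integral>\<^sup>+u. ennreal (exp (- profile \<kappa> \<epsilon> u)) \<partial>lborel) = ennreal z"
    "(\<integral>\<^sup>+u. ennreal (u\<^sup>2 * exp (- profile \<kappa> \<epsilon> u)) \<partial>lborel) = ennreal m"
  shows "integrable (Rd_lborel d) (\<lambda>x. exp (- basin d \<kappa> \<epsilon> \<sigma> x))"
    and "second_moment d (gibbs d (basin d \<kappa> \<epsilon> \<sigma>)) = ennreal (d * \<sigma>\<^sup>2 * (m / z))"
proof -
  have pos: "(\<sigma> * z) ^ d > 0" using assms by simp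
  note b = second_moment_gibbs_bounds[OF borel_measurable_basin pos,
      OF eq_refl[OF nn_integral_basin(1)[OF assms, symmetric]]
        eq_refl[OF nn_integral_basin(1)[OF assms]] _
        eq_refl[OF nn_integral_basin(2)[OF assms, symmetric]]
        eq_refl[OF nn_integral_basin(2)[OF assms]]]
  have nn: "0 \<le> d * \<sigma>\<^sup>2 * (m / z) * (\<sigma> * z) ^ d" using assms by simp
  show "integrable (Rd_lborel d) (\<lambda>x. exp (- basin d \<kappa> \<epsilon> \<sigma> x))" by (rule b(1)[OF nn])
  show "second_moment d (gibbs d (basin d \<kappa> \<epsilon> \<sigma>)) = ennreal (d * \<sigma>\<^sup>2 * (m / z))"
    using b(2,3)[OF nn] pos by (intro antisym) (simp_all only: nonzero_mult_div_cancel_right less_imp_neq[symmetric] less_numeral_extra not_False_eq_True)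
qed

text \<open>The bump raises the density only on its ball, and to at most \<open>exp 1\<close>,
  because a pitted basin is at least -1. So the normaliser grows by a factor of at most
  \<open>1 + exp 1 * \<theta>\<close>, and the moment integral by at most
  \<open>exp 1 * S * \<theta>\<close> normalisers. The lower bound pairs the old moment integral
  with the enlarged normaliser, the upper bound the enlarged integral with the old
  normaliser.\<close>

lemma gibbs_pitted:
  assumes "\<sigma> > 0" "z > 0" "m \<ge> 0" "\<kappa> \<ge> 0" "r > 0" "d > 0"
    "(\<integral>\<^sup>+u. ennreal (exp (- profile \<kappa> \<epsilon> u)) \<partial>lborel) = ennreal z"
    "(\<integral>\<^sup>+u. ennreal (u\<^sup>2 * exp (- profile \<kappa> \<epsilon> u)) \<partial>lborel) = ennreal m"
    and \<theta>: "ball_bound d r \<le> \<theta> * (\<sigma> * z) ^ d"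
    and S: "\<And>x. Rd_dist d x v \<le> r \<Longrightarrow> (Rd_norm d x)\<^sup>2 \<le> S" "0 \<le> S"
  shows "integrable (Rd_lborel d) (\<lambda>x. exp (- pitted d \<kappa> \<epsilon> \<sigma> r v x))"
    and "ennreal (d * \<sigma>\<^sup>2 * (m / z) / (1 + exp 1 * \<theta>)) \<le> second_moment d (gibbs d (pitted d \<kappa> \<epsilon> \<sigma> r v))"
    and "second_moment d (gibbs d (pitted d \<kappa> \<epsilon> \<sigma> r v)) \<le> ennreal (d * \<sigma>\<^sup>2 * (m / z) + exp 1 * S * \<theta>)"
proof -
  define f where "f = pitted d \<kappa> \<epsilon> \<sigma> r v"
  define g where "g = basin d \<kappa> \<epsilon> \<sigma>"
  define B where "B = {x \<in> Rd d. Rd_dist d x v \<le> r}"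
  define Z where "Z = (\<sigma> * z) ^ d"
  define s where "s = d * \<sigma>\<^sup>2 * (m / z)"
  have [measurable]: "f \<in> borel_measurable (Rd_lborel d)" "g \<in> borel_measurable (Rd_lborel d)"
    by (auto simp: f_def g_def)
  have [measurable]: "B \<in> sets (Rd_lborel d)"
    unfolding B_def space_Rd_lborel[symmetric] by measurable
  have Z: "Z > 0" using assms by (simp add: Z_def)
  have s: "s \<ge> 0" using assms by (simp add: s_def)
  have "0 < \<theta> * Z" using ball_bound_pos[OF assms(5,6)] \<theta> unfolding Z_def by linarith
  hence \<theta>0: "\<theta> > 0" using Z by (simp add: zero_less_mult_iff)
  have B: "emeasure (Rd_lborel d) B \<le> ennreal (\<theta> * Z)"
    unfolding B_def using emeasure_ball_le[OF assms(5,6), of v] ennreal_leI[OF \<theta>[folded Z_def]]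
    by (rule order_trans)
  have lower: "exp (- g x) \<le> exp (- f x)" for x
    using bump_bounds[of d r v x] by (simp add: f_def g_def pitted_def)
  have upper: "exp (- f x) \<le> exp (- g x) + exp 1 * indicator B x" if "x \<in> Rd d" for x
  proof (cases "x \<in> B")
    case True
    have "- f x \<le> 1"
      using bump_bounds[of d r v x] basin_nonneg[OF assms(4), of d \<epsilon> \<sigma> x] by (simp add: f_def pitted_def)
    thus ?thesis using True by (simp add: add_increasing)
  next
    case False
    hence "f x = g x"
      using bump_outside(1)[OF assms(5), of d x v] that by (simp add: f_def g_def pitted_def B_def)
    thus ?thesis using False by simp
  qed
  note basin = nn_integral_basin[OF assms(1-3,7,8), of d, folded g_def, folded Z_def, folded s_def]
  have Z1: "ennreal Z \<le> (\<integral>\<^sup>+x. ennreal (exp (- f x)) \<partial>Rd_lborel d)"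
    unfolding basin(1)[symmetric] by (intro nn_integral_mono ennreal_leI lower)
  have N1: "ennreal (s * Z) \<le> (\<integral>\<^sup>+x. ennreal ((Rd_norm d x)\<^sup>2 * exp (- f x)) \<partial>Rd_lborel d)"
    unfolding basin(2)[symmetric] by (intro nn_integral_mono ennreal_leI mult_left_mono lower) auto
  have "(\<integral>\<^sup>+x. ennreal (exp (- f x)) \<partial>Rd_lborel d)
      \<le> (\<integral>\<^sup>+x. ennreal (exp (- g x)) + ennreal (exp 1) * indicator B x \<partial>Rd_lborel d)"
  proof (rule nn_integral_mono)
    fix x assume "x \<in> space (Rd_lborel d)"
    from ennreal_leI[OF upper[OF this[unfolded space_Rd_lborel]]]
    show "ennreal (exp (- f x)) \<le> ennreal (exp (- g x)) + ennreal (exp 1) * indicator B x"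
      by (simp add: ennreal_plus ennreal_mult ennreal_indicator split: split_indicator)
  qed
  also have "\<dots> = ennreal Z + ennreal (exp 1) * emeasure (Rd_lborel d) B"
    by (subst nn_integral_add) (auto simp: basin(1) nn_integral_cmult_indicator)
  also have "\<dots> \<le> ennreal Z + ennreal (exp 1) * ennreal (\<theta> * Z)"
    using B by (intro add_left_mono mult_left_mono) auto
  also have "\<dots> = ennreal ((1 + exp 1 * \<theta>) * Z)"
    using Z \<theta>0 by (simp add: ennreal_mult[symmetric] ennreal_plus[symmetric] algebra_simps del: ennreal_plus)
  finally have Z2: "(\<integral>\<^sup>+x. ennreal (exp (- f x)) \<partial>Rd_lborel d) \<le> ennreal ((1 + exp 1 * \<theta>) * Z)" .
  have "(\<integral>\<^sup>+x. ennreal ((Rd_norm d x)\<^sup>2 * exp (- f x)) \<partial>Rd_lborel d)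
      \<le> (\<integral>\<^sup>+x. ennreal ((Rd_norm d x)\<^sup>2 * exp (- g x)) + ennreal (exp 1 * S) * indicator B x \<partial>Rd_lborel d)"
  proof (rule nn_integral_mono)
    fix x assume "x \<in> space (Rd_lborel d)"
    hence x: "x \<in> Rd d" by (simp add: space_Rd_lborel)
    have "(Rd_norm d x)\<^sup>2 * exp (- f x) \<le> (Rd_norm d x)\<^sup>2 * (exp (- g x) + exp 1 * indicator B x)"
      by (intro mult_left_mono upper x) auto
    also have "\<dots> \<le> (Rd_norm d x)\<^sup>2 * exp (- g x) + exp 1 * S * indicator B x"
      using S(1)[of x] by (auto simp: B_def algebra_simps split: split_indicator)
    finally have "ennreal ((Rd_norm d x)\<^sup>2 * exp (- f x)) \<le> ennreal \<dots>" by (rule ennreal_leI)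
    thus "ennreal ((Rd_norm d x)\<^sup>2 * exp (- f x))
        \<le> ennreal ((Rd_norm d x)\<^sup>2 * exp (- g x)) + ennreal (exp 1 * S) * indicator B x"
      using S(2) by (auto simp: ennreal_plus split: split_indicator_asm)
  qed
  also have "\<dots> = ennreal (s * Z) + ennreal (exp 1 * S) * emeasure (Rd_lborel d) B"
    by (subst nn_integral_add) (auto simp: basin(2) nn_integral_cmult_indicator)
  also have "\<dots> \<le> ennreal (s * Z) + ennreal (exp 1 * S) * ennreal (\<theta> * Z)"
    using B by (intro add_left_mono mult_left_mono) auto
  also have "\<dots> = ennreal ((s + exp 1 * S * \<theta>) * Z)"
    using Z \<theta>0 s S(2) by (simp add: ennreal_mult[symmetric] ennreal_plus[symmetric] algebra_simps del: ennreal_plus)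
  finally have N2: "(\<integral>\<^sup>+x. ennreal ((Rd_norm d x)\<^sup>2 * exp (- f x)) \<partial>Rd_lborel d)
      \<le> ennreal ((s + exp 1 * S * \<theta>) * Z)" .
  have sZ: "0 \<le> s * Z" using s Z by simp
  note b = second_moment_gibbs_bounds[OF \<open>f \<in> _\<close> Z Z1 Z2 sZ N1 N2]
  show "integrable (Rd_lborel d) (\<lambda>x. exp (- pitted d \<kappa> \<epsilon> \<sigma> r v x))"
    using b(1) by (simp add: f_def)
  show "ennreal (d * \<sigma>\<^sup>2 * (m / z) / (1 + exp 1 * \<theta>)) \<le> second_moment d (gibbs d (pitted d \<kappa> \<epsilon> \<sigma> r v))"
    using b(2) Z unfolding f_def s_def nonzero_mult_divide_mult_cancel_right[OF less_imp_neq[OF Z, symmetric]] by simp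
  show "second_moment d (gibbs d (pitted d \<kappa> \<epsilon> \<sigma> r v)) \<le> ennreal (d * \<sigma>\<^sup>2 * (m / z) + exp 1 * S * \<theta>)"
    using b(3) unfolding f_def s_def nonzero_mult_div_cancel_right[OF less_imp_neq[OF Z, symmetric]] .
qed

section \<open>The lower bound\<close>

lemma minimizer_basin:
  assumes "\<kappa> \<ge> 0" "\<epsilon> \<ge> 0" "\<sigma> > 0"
  shows "minimizer d (basin d \<kappa> \<epsilon> \<sigma>) (\<lambda>i\<in>{..<d}. 0)"
proof -
  have "basin d \<kappa> \<epsilon> \<sigma> (\<lambda>i\<in>{..<d}. 0) = 0"
    using assms by (intro basin_eq_0) simp_all
  thus ?thesis using basin_nonneg[OF assms(1)] by (simp add: minimizer_def Rd_def)
qed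

lemma cubeD: "v \<in> cube d \<rho> \<Longrightarrow> i < d \<Longrightarrow> - \<rho> \<le> v i \<and> v i \<le> \<rho>"
  using PiE_mem[of v "{..<d}" "\<lambda>_. {- \<rho>..\<rho>}" i] by (simp add: cube_def)

lemma pitted_centre:
  assumes "\<epsilon> \<ge> 0" "\<sigma> > 0" "v \<in> cube d (\<epsilon> * \<sigma>)"
  shows "pitted d \<kappa> \<epsilon> \<sigma> r v v = - 1"
proof -
  have "\<bar>v i\<bar> \<le> \<epsilon> * \<sigma>" if "i < d" for i
    using cubeD[OF assms(3) that] by (simp add: abs_le_iff)
  hence "basin d \<kappa> \<epsilon> \<sigma> v = 0" by (rule basin_eq_0[OF assms(1,2)])
  thus ?thesis by (simp add: pitted_def bump_centre)
qed

lemma pitted_ge: "\<kappa> \<ge> 0 \<Longrightarrow> - 1 \<le> pitted d \<kappa> \<epsilon> \<sigma> r v x"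
  using basin_nonneg[of \<kappa> d \<epsilon> \<sigma> x] bump_bounds(2)[of d r v x] by (simp add: pitted_def)

text \<open>Supplies the bound \<open>S\<close> on the squared norm over a bump.\<close>

lemma Rd_norm_cube_ball:
  assumes "v \<in> cube d \<rho>" "Rd_dist d x v \<le> r"
  shows "(Rd_norm d x)\<^sup>2 \<le> 2 * (d * \<rho>\<^sup>2) + 2 * r\<^sup>2"
proof -
  have "(v i)\<^sup>2 \<le> \<rho>\<^sup>2" if "i < d" for i
  proof -
    have "\<bar>v i\<bar> \<le> \<rho>" using cubeD[OF assms(1) that] by (simp add: abs_le_iff)
    from power_mono[OF this, of 2] show ?thesis by simp
  qed
  hence v: "(Rd_norm d v)\<^sup>2 \<le> d * \<rho>\<^sup>2"
    unfolding Rd_norm_sq using sum_bounded_above[of "{..<d}" "\<lambda>i. (v i)\<^sup>2" "\<rho>\<^sup>2"] by simp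
  have "Rd_norm d x \<le> Rd_dist d x v + Rd_norm d v"
    using L2_set_triangle_ineq[of "\<lambda>i. x i - v i" v "{..<d}"] by (simp add: Rd_dist_def Rd_norm_def)
  hence "(Rd_norm d x)\<^sup>2 \<le> (Rd_dist d x v + Rd_norm d v)\<^sup>2"
    by (intro power_mono) (auto simp: Rd_norm_def L2_set_nonneg)
  also have "\<dots> \<le> 2 * (Rd_dist d x v)\<^sup>2 + 2 * (Rd_norm d v)\<^sup>2"
    using zero_le_power2[of "Rd_dist d x v - Rd_norm d v"] by (simp add: power2_sum power2_diff)
  also have "\<dots> \<le> 2 * r\<^sup>2 + 2 * (d * \<rho>\<^sup>2)"
    by (intro add_mono mult_left_mono v power_mono assms(2)) simp_all
  finally show ?thesis by simp
qed

text \<open>\<open>\<eta>\<close> is the share of the curvature \<open>L\<close> reserved for the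
  bump, \<open>\<delta>\<close> the tolerated volume of a bump relative to the normaliser, and
  \<open>\<gamma>\<close> is tuned so that the cube has \<open>sqrt (\<gamma> * L * M) ^ d\<close>
  times the volume bound of a ball of radius \<open>2 * r\<close>.\<close>

lemma pitted_query_lower_bound:
  fixes d K :: nat and L M :: real
  assumes \<kappa>: "\<kappa> > 0" and \<epsilon>: "\<epsilon> > 0" and z: "2 * \<epsilon> \<le> z" and m: "m \<ge> 0"
    and int: "(\<integral>\<^sup>+u. ennreal (exp (- profile \<kappa> \<epsilon> u)) \<partial>lborel) = ennreal z"
    "(\<integral>\<^sup>+u. ennreal (u\<^sup>2 * exp (- profile \<kappa> \<epsilon> u)) \<partial>lborel) = ennreal m"
    and d: "d \<ge> 2" and LM: "L > 0" "M > 0" and \<eta>: "\<eta> > 0" "1 \<le> \<eta> * L * M"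
    and smooth: "\<kappa> * d / M + \<eta> * L \<le> L"
    and \<gamma>: "\<gamma> = \<epsilon>\<^sup>2 * \<eta> / (24 * pi * exp 1)" "1 \<le> \<gamma> * L * M" "1 / (\<gamma> * L * M) \<le> \<delta>"
    and ab: "0 < a" "a * (1 + exp 1 * \<delta>) \<le> m / z" "m / z + exp 1 * (2 * \<epsilon>\<^sup>2 + 24) * \<delta> \<le> b"
    and alg: "randomized_algorithm d P A" and p: "p > 0"
    and guar: "\<And>f. smooth d L f \<Longrightarrow> integrable (Rd_lborel d) (\<lambda>x. exp (- f x)) \<Longrightarrow>
         ennreal (a * M) \<le> second_moment d (gibbs d f) \<Longrightarrow>
         second_moment d (gibbs d f) \<le> ennreal (b * M) \<Longrightarrow> guarantees d P A K p f"
  shows "p * sqrt (\<gamma> * L * M) ^ d \<le> K"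
proof -
  define \<sigma> where "\<sigma> = sqrt (M / d)"
  \<comment> \<open>Solves \<open>12 / r^2 = \<eta> * L\<close>.\<close>
  define r where "r = sqrt (12 / (\<eta> * L))"
  define q where "q = sqrt (\<gamma> * L * M)"
  \<comment> \<open>Bounds the volume of a bump relative to \<open>(\<sigma> * z) ^ d\<close>, the
    integral of the basin density.\<close>
  define \<theta> where "\<theta> = 1 / q ^ d"
  define \<rho> where "\<rho> = \<epsilon> * \<sigma>"
  have d0: "d > 0" using d by simp
  have \<sigma>: "\<sigma> > 0" "\<sigma>\<^sup>2 = M / d" using LM d0 by (auto simp: \<sigma>_def)
  have r: "r > 0" "r\<^sup>2 = 12 / (\<eta> * L)" using LM \<eta> by (auto simp: r_def)
  have q: "q \<ge> 1" "q\<^sup>2 = \<gamma> * L * M" using \<gamma>(2) by (auto simp: q_def)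
  have z0: "z > 0" and \<rho>: "\<rho> > 0" using z \<epsilon> \<sigma> by (auto simp: \<rho>_def)
  have \<kappa>0: "\<kappa> \<ge> 0" and \<epsilon>0: "\<epsilon> \<ge> 0" using \<kappa> \<epsilon> by auto
  have \<theta>: "0 < \<theta>" "\<theta> \<le> \<delta>"
  proof -
    \<comment> \<open>This removes the dimension from the bound on \<open>\<theta>\<close>.\<close>
    have "q\<^sup>2 \<le> q ^ d" using d q(1) by (rule power_increasing)
    hence "\<theta> \<le> 1 / q\<^sup>2" unfolding \<theta>_def using q(1) by (intro divide_left_mono) auto
    thus "\<theta> \<le> \<delta>" using \<gamma>(3) q(2) by simp
    show "0 < \<theta>" using q(1) by (simp add: \<theta>_def)
  qed

  have volume: "(2 * \<rho>) ^ d = q ^ d * ball_bound d (2 * r)"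
  proof -
    \<comment> \<open>The bases of the \<open>d\<close>-th powers are compared. Solving \<open>q^2 *
      96 * pi * exp 1 / (\<eta> * L * d) = 4 * \<epsilon>^2 * M / d\<close> for \<open>q^2\<close>
      gives the 24 in \<open>\<gamma>\<close>.\<close>
    have "(q * (sqrt (2 * pi * exp 1) * (2 * r) / sqrt d))\<^sup>2 = \<gamma> * L * M * (2 * pi * exp 1 * (4 * (12 / (\<eta> * L))) / d)"
      by (simp add: power_mult_distrib power_divide q(2) r(2))
    also have "\<dots> = 4 * \<epsilon>\<^sup>2 * (M / d)"
      unfolding \<gamma>(1) using LM \<eta> d0 by (simp add: field_simps)
    also have "\<dots> = (2 * \<rho>)\<^sup>2" by (simp add: \<rho>_def power_mult_distrib \<sigma>(2))
    finally have "q * (sqrt (2 * pi * exp 1) * (2 * r) / sqrt d) = 2 * \<rho>"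
      using q(1) r(1) \<rho> by (subst (asm) power2_eq_iff_nonneg) auto
    thus ?thesis unfolding ball_bound_def power_mult_distrib[symmetric] by simp
  qed
  have "ball_bound d r \<le> ball_bound d (2 * r)"
    unfolding ball_bound_def using r(1) by (intro power_mono divide_right_mono mult_left_mono) auto
  also have "\<dots> = \<theta> * (2 * \<rho>) ^ d" unfolding volume \<theta>_def using q(1) by simp
  also have "\<dots> \<le> \<theta> * (\<sigma> * z) ^ d"
    using \<theta> z \<sigma> \<rho> by (intro mult_left_mono power_mono) (auto simp: \<rho>_def mult.commute mult_left_mono)
  finally have ball: "ball_bound d r \<le> \<theta> * (\<sigma> * z) ^ d" .

  \<comment> \<open>Rounding up adds less than 1, which the extra ball in
    \<open>exists_separated_points\<close> accommodates.\<close>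
  define N where "N = nat \<lceil>q ^ d\<rceil>"
  have N: "q ^ d \<le> N" "N < q ^ d + 1"
    using q(1) by (auto simp: N_def) linarith+
  have "real N * ball_bound d (2 * r) < (q ^ d + 1) * ball_bound d (2 * r)"
    using N(2) r(1) d0 by (intro mult_strict_right_mono ball_bound_pos) auto
  hence "\<exists>V. finite V \<and> card V = N \<and> V \<subseteq> cube d \<rho> \<and> (\<forall>u\<in>V. \<forall>v\<in>V. u \<noteq> v \<longrightarrow> 2 * r < Rd_dist d u v)"
    using r(1) d0 \<rho> unfolding distrib_right volume[symmetric]
    by (intro exists_separated_points) auto
  then obtain V where V: "finite V" "card V = N" "V \<subseteq> cube d \<rho>"
    and sep: "\<forall>u\<in>V. \<forall>v\<in>V. u \<noteq> v \<longrightarrow> 2 * r < Rd_dist d u v" by (elim exE conjE)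

  define F where "F v = pitted d \<kappa> \<epsilon> \<sigma> r v" for v
  define B where "B v = {x \<in> Rd d. Rd_dist d x v < r}" for v
  have guarF: "guarantees d P A K p (F v)" if v: "v \<in> V" for v
  proof (rule guar)
    have "\<kappa> / \<sigma>\<^sup>2 + 12 / r\<^sup>2 \<le> L" using smooth by (simp add: \<sigma>(2) r(2))
    thus "smooth d L (F v)" unfolding F_def by (intro smooth_pitted \<kappa>0 \<epsilon>0 \<sigma> r)
    have S: "(Rd_norm d x)\<^sup>2 \<le> (2 * \<epsilon>\<^sup>2 + 24) * M" if "Rd_dist d x v \<le> r" for x
    proof -
      have "d * \<rho>\<^sup>2 = \<epsilon>\<^sup>2 * M" using d0 by (simp add: \<rho>_def power_mult_distrib \<sigma>(2))
      \<comment> \<open>This is \<open>1 \<le> \<eta> * L * M\<close>. The ball thus contributes 24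
        and the flat cube \<open>2 * \<epsilon>^2\<close> to the factor of \<open>M\<close>.\<close>
      moreover have "r\<^sup>2 \<le> 12 * M"
        using \<eta> LM by (simp add: r(2) field_simps)
      moreover have "v \<in> cube d \<rho>" using v V(3) by auto
      ultimately show ?thesis
        using Rd_norm_cube_ball[of v d \<rho> x r] that by (simp add: algebra_simps)
    qed
    have S0: "0 \<le> (2 * \<epsilon>\<^sup>2 + 24) * M" using LM by simp
    note g = gibbs_pitted[OF \<sigma>(1) z0 m \<kappa>0 r(1) d0 int ball S S0]
    have dM: "d * \<sigma>\<^sup>2 = M" using d0 by (simp add: \<sigma>(2))
    show "integrable (Rd_lborel d) (\<lambda>x. exp (- F v x))" unfolding F_def by (rule g(1))
    have "a * M \<le> M * (m / z) / (1 + exp 1 * \<theta>)"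
    proof -
      have "a * (1 + exp 1 * \<theta>) \<le> a * (1 + exp 1 * \<delta>)"
        using \<theta> ab(1) by (intro mult_left_mono add_left_mono) auto
      hence "M * (a * (1 + exp 1 * \<theta>)) \<le> M * (m / z)"
        using ab(2) LM by (intro mult_left_mono) auto
      moreover have "1 + exp 1 * \<theta> > 0" using \<theta> by (intro add_pos_pos mult_pos_pos) auto
      ultimately show ?thesis by (simp only: pos_le_divide_eq mult_ac)
    qed
    from ennreal_leI[OF this] g(2)[unfolded dM]
    show "ennreal (a * M) \<le> second_moment d (gibbs d (F v))" unfolding F_def by (rule order_trans)
    have "M * (m / z) + exp 1 * ((2 * \<epsilon>\<^sup>2 + 24) * M) * \<theta> \<le> b * M"
    proof -
      have "m / z + exp 1 * (2 * \<epsilon>\<^sup>2 + 24) * \<theta> \<le> m / z + exp 1 * (2 * \<epsilon>\<^sup>2 + 24) * \<delta>"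
        using \<theta> by (intro add_left_mono mult_left_mono) auto
      hence "M * (m / z + exp 1 * (2 * \<epsilon>\<^sup>2 + 24) * \<theta>) \<le> M * b"
        using order_trans[OF _ ab(3)] LM(2) by (intro mult_left_mono) simp_all
      thus ?thesis by (simp add: algebra_simps)
    qed
    from g(3)[unfolded dM] ennreal_leI[OF this]
    show "second_moment d (gibbs d (F v)) \<le> ennreal (b * M)" unfolding F_def by (rule order_trans)
  qed
  have centre: "F v v = - 1" "v \<in> Rd d" if "v \<in> V" for v
  proof -
    have v: "v \<in> cube d \<rho>" using that V(3) by auto
    show "F v v = - 1" unfolding F_def by (rule pitted_centre[OF \<epsilon>0 \<sigma>(1) v[unfolded \<rho>_def]])
    show "v \<in> Rd d" using v cube_subset_Rd by auto
  qed
  have "p * real (card V) \<le> real K"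
  proof (rule query_lower_bound[where F = F and z = "\<lambda>v. v" and B = B and f = "basin d \<kappa> \<epsilon> \<sigma>", OF alg V(1) p guarF])
    fix v assume v: "v \<in> V"
    show "minimizer d (F v) v"
      using centre[OF v] pitted_ge[OF \<kappa>0] by (auto simp: minimizer_def F_def)
    fix x assume "x \<in> Rd d - B v"
    hence x: "r \<le> Rd_dist d x v" "x \<in> Rd d" by (auto simp: B_def)
    note out = pitted_outside[OF \<kappa>0 \<epsilon>0 \<sigma>(1) r(1) x, folded F_def]
    show "F v x = basin d \<kappa> \<epsilon> \<sigma> x \<and> gradient d (F v) x = gradient d (basin d \<kappa> \<epsilon> \<sigma>) x"
      using out by simp
    show "F v v + 1 \<le> F v x"
      using centre(1)[OF v] out(1) basin_nonneg[OF \<kappa>0] by simp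
  next
    show "disjoint_family_on B V"
      unfolding disjoint_family_on_def
    proof (intro ballI impI equals0I)
      fix u v x assume uv: "u \<in> V" "v \<in> V" "u \<noteq> v" and x: "x \<in> B u \<inter> B v"
      show False
        using sep[rule_format, OF uv] x Rd_dist_triangle[of d u v x] by (auto simp: B_def Rd_dist_commute[of d u x])
    qed
  qed
  moreover have "p * q ^ d \<le> p * real (card V)" using N(1) V(2) p by simp
  ultimately show ?thesis unfolding q_def by linarith
qed

theorem theorem1p4:
  fixes a b c p :: real
  assumes "0 < a" and "a < b" and "0 < c" and "1 < b * c"
    and "0 < p" and "p \<le> 1"
  shows "\<exists>\<alpha>>0. \<forall>(d::nat) (L::real) (M::real) (K::nat) P A.
    d \<ge> 8 \<longrightarrow> L > 0 \<longrightarrow> M > 0 \<longrightarrow> L * M \<ge> c * real d \<longrightarrow>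
    randomized_algorithm d P A \<longrightarrow>
    (\<forall>f. smooth d L f \<and> integrable (Rd_lborel d) (\<lambda>x. exp (- f x)) \<and>
         ennreal (a * M) \<le> second_moment d (gibbs d f) \<and>
         second_moment d (gibbs d f) \<le> ennreal (b * M)
         \<longrightarrow> guarantees d P A K p f) \<longrightarrow>
    real K \<ge> (\<alpha> * (L * M)) powr (real d / 2)"
proof -
  have "1 / b < min (1 / a) c"
    using assms by (auto simp: field_simps)
  then obtain \<kappa> where \<kappa>: "1 / b < \<kappa>" "\<kappa> < 1 / a" "\<kappa> < c" by (metis dense min_less_iff_conj)
  have b: "b > 0" using assms by linarith
  have \<kappa>0: "\<kappa> > 0" using \<kappa>(1) b by (meson divide_pos_pos less_trans zero_less_one)
  have inv: "a < 1 / \<kappa>" "1 / \<kappa> < b" using \<kappa> \<kappa>0 assms(1) b by (auto simp: field_simps)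
  obtain \<epsilon> z m where prof: "\<epsilon> > 0" "2 * \<epsilon> \<le> z" "a * z < m" "m < b * z"
    "(\<integral>\<^sup>+u. ennreal (exp (- profile \<kappa> \<epsilon> u)) \<partial>lborel) = ennreal z"
    "(\<integral>\<^sup>+u. ennreal (u\<^sup>2 * exp (- profile \<kappa> \<epsilon> u)) \<partial>lborel) = ennreal m"
    by (rule exists_profile[OF \<kappa>0 inv])
  have z: "z > 0" using prof(1,2) by linarith
  have m: "m \<ge> 0" using less_trans[OF mult_pos_pos[OF assms(1) z] prof(3)] by simp
  have s: "a < m / z" "m / z < b" using prof(3,4) z by (auto simp: field_simps)
  \<comment> \<open>Because \<open>d \<le> L * M / c\<close>, the basin's curvature
    \<open>\<kappa> * d / M\<close> is at most the fraction \<open>\<kappa> / c\<close> of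
    \<open>L\<close>.\<close>
  define \<eta> where "\<eta> = 1 - \<kappa> / c"
  have \<eta>: "\<eta> > 0" using \<kappa> assms(3) by (simp add: \<eta>_def)
  define \<gamma> where "\<gamma> = \<epsilon>\<^sup>2 * \<eta> / (24 * pi * exp 1)"
  have \<gamma>: "\<gamma> > 0" using prof(1) \<eta> by (simp add: \<gamma>_def)
  \<comment> \<open>The two terms solve \<open>a * (1 + exp 1 * \<delta>) = m / z\<close> and
    \<open>m / z + exp 1 * (2 * \<epsilon>^2 + 24) * \<delta> = b\<close>: a bump may use up the
    distance of \<open>m / z\<close> from \<open>a\<close> and from \<open>b\<close>, but no
    more.\<close>
  define \<delta> where "\<delta> = min ((m / z - a) / (a * exp 1)) ((b - m / z) / (exp 1 * (2 * \<epsilon>\<^sup>2 + 24)))"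
  have C: "0 < exp 1 * (2 * \<epsilon>\<^sup>2 + 24)" by (intro mult_pos_pos add_nonneg_pos) auto
  have \<delta>: "\<delta> > 0" using s C assms(1) by (simp add: \<delta>_def)
  have "\<delta> \<le> (m / z - a) / (a * exp 1)" by (simp add: \<delta>_def)
  hence \<delta>a: "a * (1 + exp 1 * \<delta>) \<le> m / z" using assms(1) by (simp add: pos_le_divide_eq algebra_simps)
  have "\<delta> \<le> (b - m / z) / (exp 1 * (2 * \<epsilon>\<^sup>2 + 24))" by (simp add: \<delta>_def)
  hence "\<delta> * (exp 1 * (2 * \<epsilon>\<^sup>2 + 24)) \<le> b - m / z" using C by (simp only: pos_le_divide_eq)
  hence \<delta>b: "m / z + exp 1 * (2 * \<epsilon>\<^sup>2 + 24) * \<delta> \<le> b" by (simp add: mult.commute)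
  \<comment> \<open>Once \<open>\<alpha> * (L * M) > 1\<close>, the term \<open>\<eta>\<close> keeps
    the bump radius of order \<open>sqrt M\<close>, \<open>\<gamma> * \<delta>\<close> keeps the
    bump volume within its tolerance, and \<open>\<gamma> * p\<close> absorbs the success
    probability.\<close>
  define \<alpha> where "\<alpha> = min \<eta> (min (\<gamma> * p) (\<gamma> * \<delta>))"
  have \<alpha>: "\<alpha> > 0" "\<alpha> \<le> \<eta>" "\<alpha> \<le> \<gamma> * p" "\<alpha> \<le> \<gamma> * \<delta>"
    using \<eta> \<gamma> \<delta> assms(5) by (auto simp: \<alpha>_def)
  show ?thesis
  proof (intro exI[of _ \<alpha>] conjI \<alpha>(1) allI impI)
    fix d K :: nat and L M :: real and P A
    assume d: "d \<ge> 8" and L: "L > 0" and M: "M > 0" and LM: "L * M \<ge> c * real d"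
      and alg: "randomized_algorithm d P A"
      and guar: "\<forall>f. smooth d L f \<and> integrable (Rd_lborel d) (\<lambda>x. exp (- f x)) \<and>
         ennreal (a * M) \<le> second_moment d (gibbs d f) \<and>
         second_moment d (gibbs d f) \<le> ennreal (b * M)
         \<longrightarrow> guarantees d P A K p f"
    have LM0: "L * M > 0" using L M by simp
    have "\<kappa> * d / M \<le> \<kappa> * L / c"
      using mult_left_mono[OF LM less_imp_le[OF \<kappa>0]] M assms(3) by (simp add: field_simps)
    hence smooth: "\<kappa> * d / M + \<eta> * L \<le> L" by (simp add: \<eta>_def algebra_simps)
    show "(\<alpha> * (L * M)) powr (real d / 2) \<le> real K"
    proof (cases "\<alpha> * (L * M) \<le> 1")
      \<comment> \<open>The claimed bound is at most 1, so \<open>K > 0\<close> suffices. The basin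
        itself is admissible and has a minimizer, which rules out \<open>K = 0\<close>.\<close>
      case True
      define \<sigma> where "\<sigma> = sqrt (M / d)"
      have \<sigma>: "\<sigma> > 0" "\<sigma>\<^sup>2 = M / d" using M d by (auto simp: \<sigma>_def)
      define f where "f = basin d \<kappa> \<epsilon> \<sigma>"
      note gb = gibbs_basin[OF \<sigma>(1) z m prof(5,6), of d, folded f_def]
      have dM: "d * \<sigma>\<^sup>2 * (m / z) = m / z * M" using d by (simp add: \<sigma>(2))
      have "\<kappa> / \<sigma>\<^sup>2 \<le> L" using smooth mult_pos_pos[OF \<eta> L] by (simp add: \<sigma>(2))
      hence "smooth d L f" unfolding f_def using \<kappa>0 prof(1) \<sigma>(1) by (intro smooth_basin) auto
      moreover have "a * M \<le> m / z * M" "m / z * M \<le> b * M"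
        using s M by (intro mult_right_mono; simp)+
      ultimately have "guarantees d P A K p f"
        using guar gb unfolding dM by (auto intro!: ennreal_leI)
      moreover have "minimizer d f (\<lambda>i\<in>{..<d}. 0)"
        unfolding f_def using \<kappa>0 prof(1) \<sigma>(1) by (intro minimizer_basin) auto
      ultimately have "K > 0" using assms(5) by (rule guarantees_imp_pos_queries)
      moreover have "(\<alpha> * (L * M)) powr (real d / 2) \<le> 1 powr (real d / 2)"
        using True \<alpha>(1) LM0 by (intro powr_mono2) auto
      ultimately show ?thesis by simp
    next
      case False
      have lt: "1 < u * (L * M)" if "\<alpha> \<le> u" for u
        using False mult_right_mono[OF that less_imp_le[OF LM0]] by linarith
      have "\<gamma> * p \<le> \<gamma>" using \<gamma> assms(6) by simp
      hence g1: "1 \<le> \<gamma> * L * M" using lt[of \<gamma>] \<alpha>(3) by (simp add: mult.assoc)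
      have "1 \<le> \<eta> * L * M" using lt[OF \<alpha>(2)] by (simp add: mult.assoc)
      moreover have "1 / (\<gamma> * L * M) \<le> \<delta>"
        using lt[OF \<alpha>(4)] g1 by (simp add: divide_le_eq mult_ac)
      ultimately have main: "p * sqrt (\<gamma> * L * M) ^ d \<le> K"
        using d guar
        by (intro pitted_query_lower_bound[OF \<kappa>0 prof(1,2) m prof(5,6) _ L M \<eta> _ smooth \<gamma>_def g1 _
            assms(1) \<delta>a \<delta>b alg assms(5)]) simp_all
      have "(\<alpha> * (L * M)) powr (real d / 2) = sqrt (\<alpha> * (L * M)) ^ d"
      proof -
        have "x powr (real d / 2) = sqrt x ^ d" if "x > 0" for x :: real
          using that by (simp add: powr_half_sqrt_powr powr_realpow real_sqrt_power)
        thus ?thesis using mult_pos_pos[OF \<alpha>(1) LM0] .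
      qed
      also have "\<dots> \<le> (sqrt p * sqrt (\<gamma> * L * M)) ^ d"
      proof (intro power_mono)
        have "\<alpha> * (L * M) \<le> \<gamma> * p * (L * M)" using \<alpha>(3) LM0 by (intro mult_right_mono) auto
        thus "sqrt (\<alpha> * (L * M)) \<le> sqrt p * sqrt (\<gamma> * L * M)"
          unfolding real_sqrt_mult[symmetric] by (simp add: mult_ac)
      qed (use \<alpha>(1) LM0 in simp)
      also have "\<dots> = sqrt p ^ d * sqrt (\<gamma> * L * M) ^ d" by (rule power_mult_distrib)
      also have "\<dots> \<le> p * sqrt (\<gamma> * L * M) ^ d"
      proof (rule mult_right_mono)
        \<comment> \<open>Since \<open>p \<le> 1\<close>, the exponent may be lowered to 2.\<close>
        have "sqrt p ^ d \<le> sqrt p ^ 2" using assms(5,6) d by (intro power_decreasing) auto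
        thus "sqrt p ^ d \<le> p" using assms(5) by simp
      qed (use g1 in simp)
      finally show ?thesis using main by linarith
    qed
  qed
qed

end
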